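(* For every pair $(n,m)$, every randomized online algorithm for minimizing total flow time on $m$ identical machines, even one that may use kill-and-restart (and knows $n$ and $m$ in advance), has competitive ratio at least $\Gamma(n,m)$ on instances with at most $n$ jobs, where $\Gamma(n,m)=\Omega(\sqrt{n/m})$.
   Context: Online scheduling of jobs on $m$ identical machines. Each job $j$ has a release time $r_j\ge 0$ and processing time $p_j>0$ and becomes known to the algorithm only at time $r_j$. Each machine processes at most one job at a time. In the kill-and-restart model the algorithm may terminate a running job at any time; all work done on it is lost, and it must later be processed again from scratch for $p_j$ uninterrupted time units (possibly on another machine). The flow time of job $j$ is $C_j-r_j$; the objective is total flow time. For this lower bound, $\mathrm{OPT}(J)$ denotes the minimum total flow time over offline non-preemptive schedules of $J$. Competitive ratio at least $\Gamma$ means there is no algorithm with $\mathbb{E}[F(\mathrm{ALG}(J))]\le c\,\Gamma\cdot\mathrm{OPT}(J)$ for all instances $J$, for a sufficiently small absolute constant $c>0$. *)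

theory Defs
  imports "HOL-Probability.Probability"
begin

(* A job is a pair (release time, processing time).  An instance is a list of jobs in order of
   release; jobs are referred to by their position, so that positions reveal nothing about
   jobs that have not been released yet. *)

type_synonym job = "real \<times> real"

abbreviation release :: "job list \<Rightarrow> nat \<Rightarrow> real" where
  "release J j \<equiv> fst (J ! j)"

abbreviation proc :: "job list \<Rightarrow> nat \<Rightarrow> real" where
  "proc J j \<equiv> snd (J ! j)"

definition valid_instance :: "nat \<Rightarrow> job list \<Rightarrow> bool" where
  "valid_instance n J \<longleftrightarrow>
     length J \<le> n \<and> sorted (map fst J) \<and> (\<forall>(r, p) \<in> set J. 0 \<le> r \<and> 0 < p)"

(* A run is one uninterrupted attempt at a job, occupying a machine during
   [run_start, run_stop).  It is killed at run_stop unless it lasts for the full processing time. *)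

datatype run = Run (run_job: nat) (run_machine: nat) (run_start: real) (run_stop: real)

type_synonym schedule = "run set"

definition completes :: "job list \<Rightarrow> run \<Rightarrow> bool" where
  "completes J x \<longleftrightarrow> run_stop x = run_start x + proc J (run_job x)"

(* Feasibility does not demand that every job gets completed; a job that is never completed
   has infinite completion time. *)

definition restart_schedule :: "nat \<Rightarrow> job list \<Rightarrow> schedule \<Rightarrow> bool" where
  "restart_schedule m J S \<longleftrightarrow>
     (\<forall>x\<in>S. run_job x < length J \<and> run_machine x < m \<and>
        release J (run_job x) \<le> run_start x \<and> run_start x < run_stop x \<and>
        run_stop x \<le> run_start x + proc J (run_job x)) \<and>
     (\<forall>x\<in>S. \<forall>y\<in>S. x \<noteq> y \<and> (run_machine x = run_machine y \<or> run_job x = run_job y) \<longrightarrow>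
        run_stop x \<le> run_start y \<or> run_stop y \<le> run_start x) \<and>
     (\<forall>x\<in>S. \<forall>y\<in>S. completes J x \<and> run_job y = run_job x \<longrightarrow> run_start y \<le> run_start x) \<and>
     (\<forall>t. finite {x \<in> S. run_start x \<le> t})"

definition nonpreemptive_schedule :: "nat \<Rightarrow> job list \<Rightarrow> schedule \<Rightarrow> bool" where
  "nonpreemptive_schedule m J S \<longleftrightarrow>
     restart_schedule m J S \<and> (\<forall>x\<in>S. completes J x) \<and>
     (\<forall>j<length J. \<exists>!x. x \<in> S \<and> run_job x = j)"

definition completion_time :: "job list \<Rightarrow> schedule \<Rightarrow> nat \<Rightarrow> ennreal" where
  "completion_time J S j =
     (INF x \<in> {x \<in> S. run_job x = j \<and> completes J x}. ennreal (run_stop x))"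

definition total_flow_time :: "job list \<Rightarrow> schedule \<Rightarrow> ennreal" where
  "total_flow_time J S = (\<Sum>j<length J. completion_time J S j - ennreal (release J j))"

definition OPT :: "nat \<Rightarrow> job list \<Rightarrow> ennreal" where
  "OPT m J = (INF S \<in> {S. nonpreemptive_schedule m J S}. total_flow_time J S)"

definition revealed :: "real \<Rightarrow> job list \<Rightarrow> job list" where
  "revealed t J = filter (\<lambda>(r, p). r \<le> t) J"

(* The part of a schedule that has been carried out by time t, including the decisions taken
   at time t itself; the stopping time of a run still in progress after t is not part of it. *)

definition history :: "real \<Rightarrow> schedule \<Rightarrow> (nat \<times> nat \<times> real \<times> real option) set" where
  "history t S =
     (\<lambda>x. (run_job x, run_machine x, run_start x,
           if run_stop x \<le> t then Some (run_stop x) else None)) ` {x \<in> S. run_start x \<le> t}"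

(* Being online means being non-anticipating: whatever is done up to time t depends only on the
   jobs released up to time t.  The parameters n and m are known to the algorithm: it only has
   to deal with instances of at most n jobs on m machines. *)

definition online_algorithm :: "nat \<Rightarrow> nat \<Rightarrow> (job list \<Rightarrow> schedule) \<Rightarrow> bool" where
  "online_algorithm n m A \<longleftrightarrow>
     (\<forall>J. valid_instance n J \<longrightarrow> restart_schedule m J (A J)) \<and>
     (\<forall>J J' t. valid_instance n J \<and> valid_instance n J' \<and> revealed t J = revealed t J' \<longrightarrow>
        history t (A J) = history t (A J'))"

(* A randomized algorithm is a probability distribution over deterministic ones.  The
   sigma-algebra is arbitrary, as long as the cost on every instance is a random variable. *)

definition randomized_online_algorithm ::
  "nat \<Rightarrow> nat \<Rightarrow> (job list \<Rightarrow> schedule) measure \<Rightarrow> bool" where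
  "randomized_online_algorithm n m M \<longleftrightarrow>
     prob_space M \<and> (\<forall>A \<in> space M. online_algorithm n m A) \<and>
     (\<forall>J. valid_instance n J \<longrightarrow> (\<lambda>A. total_flow_time J (A J)) \<in> borel_measurable M)"

definition expected_flow_time ::
  "(job list \<Rightarrow> schedule) measure \<Rightarrow> job list \<Rightarrow> ennreal" where
  "expected_flow_time M J = (\<integral>\<^sup>+ A. total_flow_time J (A J) \<partial>M)"

end

theory Submission imports Defs begin

text \<open>Put \<open>R = \<Theta>(sqrt (n / m))\<close>. An instance consists of \<open>R\<close> rounds of length 6. Each round releases
  \<open>m\<close> jobs of size 3 and \<open>m\<close> jobs of size 2 and contains two gaps, one fitting each size, in an order
  given by an independent fair bit. After each gap comes a stream of tiny jobs that needs all \<open>m\<close>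
  machines. Knowing the bits, one fits every long job into its gap, at total cost \<open>O(m R)\<close>.
  An online machine must choose its first job before the first gap reveals its length. A wrong
  choice loses a unit of volume, so that after \<open>k\<close> rounds \<open>\<Omega>(m k)\<close> long jobs are unfinished; killing
  does not help, as the time is already lost. Running a long job into a stream instead delays
  \<open>\<Omega>(R)\<close> tiny jobs per machine for constant time. Either way the expected cost is \<open>\<Omega>(m R^2)\<close>.\<close>

subsection \<open>Packing and flow-time estimates\<close>

text \<open>The sizes 3 and 2 let volume arithmetic decide which job filled a gap. Completed volumes
  are sums of 3s and 2s, so even a gap widened by \<open>1/2\<close> holds at most its nominal 3 or
  2, and a long gap is filled only by a size-3 job; with sizes 2 and 1, two small jobs could fill
  the long gap. This slack permits checkpoints inside the streams: a job that leaks a little into a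
  stream gains nothing, whereas one that crosses a checkpoint holds its machine long enough to be
  charged. The obstacle is an algorithm that mixes both options, since a crossing can rescue a
  constant volume and so lower the backlog of all later rounds. Streams of \<open>4 * R\<close> tiny
  jobs per machine balance this: a crossing costs order \<open>R\<close>, as much as the rescued
  volume would cost over at most \<open>R\<close> rounds. Order \<open>R\<close> jobs per machine in
  each of \<open>R\<close> rounds then makes \<open>n\<close> of order
  \<open>m * R^2\<close>.\<close>

lemma interval_packing:
  fixes a b :: "'i \<Rightarrow> real"
  assumes "finite I" "lo \<le> hi"
    and bounds: "\<And>i. i \<in> I \<Longrightarrow> lo \<le> a i \<and> a i \<le> b i \<and> b i \<le> hi"
    and disj: "\<And>i j. i \<in> I \<Longrightarrow> j \<in> I \<Longrightarrow> i \<noteq> j \<Longrightarrow> b i \<le> a j \<or> b j \<le> a i"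
  shows "(\<Sum>i\<in>I. b i - a i) \<le> hi - lo"
proof -
  \<comment> \<open>Half-open intervals, so that runs that merely touch are disjoint.\<close>
  have dj: "disjoint_family_on (\<lambda>i. {a i..<b i}) I"
    unfolding disjoint_family_on_def using disj by fastforce
  have "(\<Sum>i\<in>I. b i - a i) = (\<Sum>i\<in>I. measure lborel {a i..<b i})"
    using bounds by (intro sum.cong) auto
  also have "\<dots> = measure lborel (\<Union>i\<in>I. {a i..<b i})"
    using assms(1) dj bounds by (intro measure_finite_Union[symmetric]) auto
  also have "\<dots> \<le> measure lborel {lo..hi}"
    using assms(1) bounds
    by (intro measure_mono_fmeasurable fmeasurableI) (fastforce | simp add: assms(2))+
  finally show ?thesis using assms(2) by simp
qed

definition completed_by :: "job list \<Rightarrow> schedule \<Rightarrow> real \<Rightarrow> nat \<Rightarrow> bool" where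
  "completed_by J S t j \<longleftrightarrow> (\<exists>x\<in>S. run_job x = j \<and> completes J x \<and> run_stop x \<le> t)"

abbreviation flow_time :: "job list \<Rightarrow> schedule \<Rightarrow> nat \<Rightarrow> ennreal" where
  "flow_time J S j \<equiv> completion_time J S j - ennreal (release J j)"

text \<open>Job \<open>j\<close> is present and unfinished from the start of the first period in
  \<open>K\<close> to the end of the last. Because \<open>d \<le> h\<close>, the periods do not
  overlap, so this span is at least \<open>d\<close> times their number.\<close>

lemma flow_time_ge:
  assumes "0 \<le> release J j" "0 \<le> d" "d \<le> h" "finite K"
    and waiting: "\<And>k. k \<in> K \<Longrightarrow>
      release J j \<le> a + h * real k \<and> \<not> completed_by J S (a + h * real k + d) j"
    and "\<And>x. x \<in> S \<Longrightarrow> run_job x = j \<Longrightarrow> release J j \<le> run_stop x"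
  shows "ennreal (d * real (card K)) \<le> flow_time J S j"
proof -
  have "ennreal (release J j + d * real (card K)) \<le> completion_time J S j"
    unfolding completion_time_def
  proof (rule INF_greatest)
    fix x assume x: "x \<in> {x \<in> S. run_job x = j \<and> completes J x}"
    show "ennreal (release J j + d * real (card K)) \<le> ennreal (run_stop x)"
    proof (cases "K = {}")
      case True
      then show ?thesis using x assms(6) by (auto intro: ennreal_leI)
    next
      case False
      define k1 k2 where "k1 = Min K" and "k2 = Max K"
      have k: "k1 \<in> K" "k2 \<in> K" "K \<subseteq> {k1..k2}" "k1 \<le> k2"
        using False assms(4) by (auto simp: k1_def k2_def)
      have "card K \<le> card {k1..k2}" by (intro card_mono k) auto
      then have "real (card K) \<le> real k2 - real k1 + 1" using k(4) by auto
      then have "d * real (card K) \<le> d * (real k2 - real k1) + d"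
        using assms(2) by (metis mult_left_mono distrib_left mult.right_neutral)
      also have "\<dots> \<le> h * (real k2 - real k1) + d"
        using assms(3) k(4) by (intro add_right_mono mult_right_mono) auto
      finally have "d * real (card K) \<le> h * (real k2 - real k1) + d" .
      moreover have "a + h * real k2 + d < run_stop x"
        using waiting[OF k(2)] x unfolding completed_by_def by force
      moreover have "release J j \<le> a + h * real k1" using waiting[OF k(1)] by blast
      ultimately show ?thesis by (intro ennreal_leI) (simp add: algebra_simps)
    qed
  qed
  then have "ennreal (release J j + d * real (card K)) - ennreal (release J j)
      \<le> flow_time J S j"
    by (rule ennreal_minus_mono) simp
  then show ?thesis using assms(1,2) by (simp add: ennreal_minus)
qed

text \<open>Double counting of the pairs of a job and a period throughout which it waits: backlogs
  observed at regular times turn into flow time.\<close>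

lemma sum_flow_time_ge:
  fixes u :: "nat \<Rightarrow> real"
  assumes S: "restart_schedule m J S" and I: "finite I" and K: "finite K"
    and "0 \<le> d" "d \<le> h" and pos: "\<And>j. j \<in> I \<Longrightarrow> 0 \<le> release J j"
    and waiting: "\<And>k. k \<in> K \<Longrightarrow> u k \<le> real (card {j \<in> I.
      release J j \<le> a + h * real k \<and> \<not> completed_by J S (a + h * real k + d) j})"
  shows "ennreal (d * (\<Sum>k\<in>K. u k)) \<le> (\<Sum>j\<in>I. flow_time J S j)"
proof -
  define P where "P j k \<longleftrightarrow>
    release J j \<le> a + h * real k \<and> \<not> completed_by J S (a + h * real k + d) j" for j k
  have "(\<Sum>k\<in>K. u k) \<le> (\<Sum>k\<in>K. real (card {j \<in> I. P j k}))"
    using waiting by (intro sum_mono) (simp add: P_def)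
  also have "\<dots> = (\<Sum>k\<in>K. \<Sum>j\<in>I. of_bool (P j k))"
    using I by (simp add: of_bool_def sum.If_cases Int_def)
  also have "\<dots> = (\<Sum>j\<in>I. \<Sum>k\<in>K. of_bool (P j k))" by (rule sum.swap)
  also have "\<dots> = (\<Sum>j\<in>I. real (card {k \<in> K. P j k}))"
    using K by (simp add: of_bool_def sum.If_cases Int_def)
  finally have "d * (\<Sum>k\<in>K. u k) \<le> (\<Sum>j\<in>I. d * real (card {k \<in> K. P j k}))"
    using assms(4) by (metis mult_left_mono sum_distrib_left)
  then have "ennreal (d * (\<Sum>k\<in>K. u k)) \<le> ennreal (\<Sum>j\<in>I. d * real (card {k \<in> K. P j k}))"
    by (rule ennreal_leI)
  also have "\<dots> = (\<Sum>j\<in>I. ennreal (d * real (card {k \<in> K. P j k})))"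
    using assms(4) by (simp add: sum_ennreal)
  also have "\<dots> \<le> (\<Sum>j\<in>I. flow_time J S j)"
  proof (rule sum_mono)
    fix j assume j: "j \<in> I"
    have "release J j \<le> run_stop x" if "x \<in> S" "run_job x = j" for x
      using S that unfolding restart_schedule_def by fastforce
    then show "ennreal (d * real (card {k \<in> K. P j k})) \<le> flow_time J S j"
      using assms(4,5) pos[OF j] K
      by (intro flow_time_ge[where h = h and a = a]) (auto simp: P_def)
  qed
  finally show ?thesis .
qed

lemma restart_scheduleD:
  assumes "restart_schedule m J S" "x \<in> S"
  shows "run_job x < length J \<and> run_machine x < m \<and> release J (run_job x) \<le> run_start x
    \<and> run_start x < run_stop x"
proof -
  have "\<forall>x\<in>S. run_job x < length J \<and> run_machine x < m \<and>
      release J (run_job x) \<le> run_start x \<and> run_start x < run_stop x \<and>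
      run_stop x \<le> run_start x + proc J (run_job x)"
    using assms(1) unfolding restart_schedule_def by (rule conjunct1)
  then show ?thesis using assms(2) by blast
qed

lemma run_disjoint:
  assumes "restart_schedule m J S" "x \<in> S" "y \<in> S" "x \<noteq> y" "run_machine x = run_machine y"
  shows "run_stop x \<le> run_start y \<or> run_stop y \<le> run_start x"
  using assms unfolding restart_schedule_def by blast

lemma finite_runs_stopped:
  assumes "restart_schedule m J S"
  shows "finite {x \<in> S. run_stop x \<le> t}"
proof (rule finite_subset)
  show "finite {x \<in> S. run_start x \<le> t}" using assms unfolding restart_schedule_def by blast
  show "{x \<in> S. run_stop x \<le> t} \<subseteq> {x \<in> S. run_start x \<le> t}"
    using assms unfolding restart_schedule_def by force
qed

text \<open>A stream offers load exactly \<open>m\<close>, so machine time withheld from it early on turns into a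
  backlog of tiny jobs that persists until the stream ends.\<close>

lemma stream_delay:
  assumes S: "restart_schedule m J S" and m: "0 < m" and R: "0 < R" and g: "0 \<le> g"
    and stream: "\<And>l. l < 4 * R * m \<Longrightarrow>
      J ! (a + l) = (g + real (l div m) / (8 * real R), 1 / (8 * real R))"
    and Q: "Q \<subseteq> {..<m}"
    and blocked: "\<And>q. q \<in> Q \<Longrightarrow> \<exists>x\<in>S. run_machine x = q \<and> run_job x \<notin> {a..<a + 4 * R * m}
      \<and> run_start x < g + 1/8 \<and> g + 1/8 < run_stop x \<and> run_start x + 1/4 \<le> run_stop x"
  shows "ennreal (real (card Q) * real R / 4) \<le> (\<Sum>j\<in>{a..<a + 4 * R * m}. flow_time J S j)"
proof -
  define e where "e = 1 / (8 * real R)"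
  have e: "0 < e" "real R * e = 1/8" using R by (auto simp: e_def)
  have job: "release J (a + l) = g + real (l div m) * e" "proc J (a + l) = e"
    if "l < 4 * R * m" for l using stream[OF that] by (auto simp: e_def)
  \<comment> \<open>From tick \<open>2 * R\<close> on, at least \<open>1/4\<close> of the stream has
    passed, and by then a blocking run has taken \<open>1/8\<close> of its machine's time after
    \<open>g\<close>, which is the time of \<open>R\<close> tiny jobs.\<close>
  have late: "real (card Q) * real R \<le> real (card {j \<in> {a..<a + 4 * R * m}.
      release J j \<le> g + e * real k \<and> \<not> completed_by J S (g + e * real k + e) j})"
    if k: "k \<in> {2 * R..<4 * R}" for k
  proof -
    define t where "t = g + e * real k + e"
    define L where "L = {a..<a + (k + 1) * m}"
    define C where "C q = {x \<in> S. run_machine x = q \<and> run_job x \<in> L \<and> completes J x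
      \<and> run_stop x \<le> t}" for q
    have "(k + 1) * m \<le> 4 * R * m" using k by (intro mult_right_mono) auto
    then have Lsub: "L \<subseteq> {a..<a + 4 * R * m}" by (auto simp: L_def)
    have Ljob: "g \<le> release J j \<and> release J j \<le> g + e * real k \<and> proc J j = e" if "j \<in> L" for j
    proof -
      define l where "l = j - a"
      have l: "j = a + l" "l < (k + 1) * m" "l < 4 * R * m"
        using that Lsub by (auto simp: L_def l_def)
      have "l div m \<le> k" using less_mult_imp_div_less[OF l(2)] by simp
      then show ?thesis using job[OF l(3)] e(1) unfolding l(1)
        by (auto simp: mult.commute)
    qed
    have finC: "finite (C q)" for q
      by (rule finite_subset[OF _ finite_runs_stopped[OF S, of t]]) (auto simp: C_def)
    have "real k * e \<ge> real (2 * R) * e" using k e(1) by (intro mult_right_mono) auto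
    then have "1/4 \<le> e * real k" using e(2) by (simp add: mult.commute)
    then have tg: "g + 1/4 \<le> t" using e(1) by (simp add: t_def)
    \<comment> \<open>\<open>[g, t]\<close> has room for exactly \<open>k + 1\<close> tiny jobs on
      one machine, and \<open>m\<close> machines are offered \<open>(k + 1) * m\<close> of them, so
      the \<open>R\<close> places lost to a blocking run are never recovered.\<close>
    have Cq: "card (C q) + (if q \<in> Q then R else 0) \<le> k + 1" if "q < m" for q
    proof -
      have Ctime: "g \<le> run_start x \<and> run_stop x = run_start x + e \<and> run_stop x \<le> t"
        if "x \<in> C q" for x
        using that Ljob[of "run_job x"] S
        unfolding C_def restart_schedule_def completes_def by force
      \<comment> \<open>\<open>B\<close> is the blocking run if there is one. It may begin before
        \<open>g\<close> and end after \<open>t\<close>, hence the clipping. It covers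
        \<open>1/8\<close> either because it spans \<open>[g, g + 1/8]\<close> or because it starts
        before \<open>g + 1/8\<close> and lasts at least \<open>1/4\<close>.\<close>
      obtain B where B: "finite B" "B \<subseteq> S" "B \<inter> C q = {}" "\<forall>x\<in>B. run_machine x = q"
        "\<forall>x\<in>B. max g (run_start x) \<le> min t (run_stop x)"
        "(\<Sum>x\<in>B. min t (run_stop x) - max g (run_start x)) \<ge> (if q \<in> Q then 1/8 else 0)"
      proof (cases "q \<in> Q")
        case True
        then obtain x where x: "x \<in> S" "run_machine x = q" "run_job x \<notin> {a..<a + 4 * R * m}"
          "run_start x < g + 1/8" "g + 1/8 < run_stop x" "run_start x + 1/4 \<le> run_stop x"
          using blocked by blast
        have "min t (run_stop x) - max g (run_start x) \<ge> 1/8"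
          using x tg by (auto simp: min_def max_def)
        moreover have "x \<notin> C q" using x(3) Lsub by (auto simp: C_def)
        ultimately show ?thesis using x True by (intro that[of "{x}"]) auto
      next
        case False
        then show ?thesis by (intro that[of "{}"]) auto
      qed
      have "(\<Sum>x\<in>B \<union> C q. min t (run_stop x) - max g (run_start x)) \<le> t - g"
      proof (rule interval_packing)
        fix x y assume "x \<in> B \<union> C q" "y \<in> B \<union> C q" "x \<noteq> y"
        then have "run_stop x \<le> run_start y \<or> run_stop y \<le> run_start x"
          using B(2,4) by (intro run_disjoint[OF S]) (auto simp: C_def)
        then show "min t (run_stop x) \<le> max g (run_start y)
            \<or> min t (run_stop y) \<le> max g (run_start x)" by linarith
      qed (use B finC tg Ctime e(1) in \<open>fastforce+\<close>)
      also have "(\<Sum>x\<in>B \<union> C q. min t (run_stop x) - max g (run_start x))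
          = (\<Sum>x\<in>B. min t (run_stop x) - max g (run_start x)) + (\<Sum>x\<in>C q. e)"
      proof -
        have "(\<Sum>x\<in>C q. min t (run_stop x) - max g (run_start x)) = (\<Sum>x\<in>C q. e)"
        proof (intro sum.cong refl)
          fix x assume "x \<in> C q"
          from Ctime[OF this] show "min t (run_stop x) - max g (run_start x) = e" by simp
        qed
        then show ?thesis using B(1,3) finC by (simp add: sum.union_disjoint)
      qed
      finally have "real (card (C q)) * e + (if q \<in> Q then 1/8 else 0) \<le> real (k + 1) * e"
        using B(6) by (simp add: t_def algebra_simps)
      then have "(real (card (C q)) + (if q \<in> Q then real R else 0)) * e \<le> real (k + 1) * e"
        using e(2) by (auto simp: algebra_simps split: if_splits)
      then have "real (card (C q)) + (if q \<in> Q then real R else 0) \<le> real (k + 1)"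
        using e(1) by (metis mult_le_cancel_right_pos)
      then show ?thesis by (auto split: if_splits)
    qed
    define D where "D = {j \<in> L. completed_by J S t j}"
    have "D \<subseteq> run_job ` (\<Union>q<m. C q)"
    proof
      fix j assume "j \<in> D"
      then obtain x where x: "x \<in> S" "run_job x = j" "completes J x" "run_stop x \<le> t" "j \<in> L"
        by (auto simp: D_def completed_by_def)
      moreover have "run_machine x < m" using restart_scheduleD[OF S x(1)] by blast
      ultimately show "j \<in> run_job ` (\<Union>q<m. C q)" by (auto simp: C_def)
    qed
    then have "card D \<le> card (\<Union>q<m. C q)"
      using finC by (intro surj_card_le) auto
    also have "\<dots> \<le> (\<Sum>q<m. card (C q))" by (intro card_UN_le) auto
    finally have "card D + (\<Sum>q<m. if q \<in> Q then R else 0)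
        \<le> (\<Sum>q<m. card (C q) + (if q \<in> Q then R else 0))" by (simp add: sum.distrib)
    also have "\<dots> \<le> (\<Sum>q<m. k + 1)" by (intro sum_mono Cq) auto
    finally have 1: "card D + card Q * R \<le> (k + 1) * m"
      using Q by (simp add: sum.If_cases Int_absorb1 mult.commute)
    have "card L = (k + 1) * m" by (simp add: L_def)
    moreover have "card (L - D) = card L - card D"
      by (intro card_Diff_subset) (auto simp: D_def L_def)
    ultimately have "card Q * R \<le> card (L - D)" using 1 by linarith
    also have "\<dots> \<le> card {j \<in> {a..<a + 4 * R * m}. release J j \<le> g + e * real k
      \<and> \<not> completed_by J S (g + e * real k + e) j}"
      using Ljob Lsub by (intro card_mono) (auto simp: D_def t_def)
    finally show ?thesis unfolding of_nat_mult[symmetric] of_nat_le_iff .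
  qed
  have "ennreal (e * (\<Sum>k\<in>{2 * R..<4 * R}. real (card Q) * real R))
      \<le> (\<Sum>j\<in>{a..<a + 4 * R * m}. flow_time J S j)"
  proof (rule sum_flow_time_ge[OF S, where h = e and a = g])
    fix j assume j: "j \<in> {a..<a + 4 * R * m}"
    then have "j - a < 4 * R * m" by (simp add: less_diff_conv2)
    from job(1)[OF this] show "0 \<le> release J j" using j g e(1) by simp
  qed (use e(1) late in auto)
  \<comment> \<open>The \<open>2 * R\<close> observed ticks have total length
    \<open>1/4\<close>.\<close>
  moreover have "e * (\<Sum>k\<in>{2 * R..<4 * R}. real (card Q) * real R) = real (card Q) * real R / 4"
  proof -
    have "e * (\<Sum>k\<in>{2 * R..<4 * R}. real (card Q) * real R)
        = (real R * e) * 2 * (real (card Q) * real R)" by (simp add: algebra_simps)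
    then show ?thesis using e(2) by simp
  qed
  ultimately show ?thesis by (simp only:)
qed

subsection \<open>The hard instances\<close>

definition first_stream :: "nat set \<Rightarrow> nat \<Rightarrow> real" where
  "first_stream w i = 6 * real i + (if i \<in> w then 3 else 2)"

definition block :: "nat \<Rightarrow> nat \<Rightarrow> nat" where
  "block m R = (2 + 8 * R) * m"

definition tick :: "nat \<Rightarrow> nat \<Rightarrow> nat \<Rightarrow> real" where
  "tick m R l = real (l div m) / (8 * real R)"

text \<open>Each stream lasts \<open>1/2\<close> and releases \<open>m\<close> tiny jobs per tick.
  The second gap therefore runs from \<open>first_stream w i + 1/2\<close> to
  \<open>6 * i + 11/2\<close> and has the length that the first gap lacks:
  \<open>3 + 2 + 2 * 1/2 = 6\<close>. Which position holds which kind of job does not depend on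
  \<open>w\<close>, so indices leak no bits.\<close>

definition hard_job :: "nat \<Rightarrow> nat \<Rightarrow> nat set \<Rightarrow> nat \<Rightarrow> nat \<Rightarrow> job" where
  "hard_job m R w i r =
     (if r < m then (6 * real i, 3)
      else if r < 2 * m then (6 * real i, 2)
      else if r < 2 * m + 4 * R * m
        then (first_stream w i + tick m R (r - 2 * m), 1 / (8 * real R))
      else (6 * real i + 11/2 + tick m R (r - (2 * m + 4 * R * m)),
            1 / (8 * real R)))"

definition hard_instance :: "nat \<Rightarrow> nat \<Rightarrow> nat set \<Rightarrow> job list" where
  "hard_instance m R w = map (\<lambda>j. hard_job m R w (j div block m R) (j mod block m R)) [0..<R * block m R]"

lemma length_hard_instance [simp]: "length (hard_instance m R w) = R * block m R"
  by (simp add: hard_instance_def)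

lemma nth_hard_instance:
  "j < R * block m R \<Longrightarrow>
    hard_instance m R w ! j = hard_job m R w (j div block m R) (j mod block m R)"
  by (simp add: hard_instance_def)

lemma tick_nonneg: "0 \<le> tick m R l"
  by (simp add: tick_def)

lemma tick_mono: "l \<le> l' \<Longrightarrow> tick m R l \<le> tick m R l'"
  unfolding tick_def by (intro divide_right_mono) (auto intro!: div_le_mono)

text \<open>The \<open>4 * R\<close> ticks of length \<open>1 / (8 * R)\<close> exactly fill the
  half unit of a stream.\<close>

lemma tick_bound:
  assumes "l < 4 * R * m"
  shows "tick m R l + 1 / (8 * real R) \<le> 1/2"
proof -
  have R: "0 < R" using assms by (cases R) auto
  have "l div m < 4 * R" using assms by (rule less_mult_imp_div_less)
  then have "real (l div m) + 1 \<le> 4 * real R" by linarith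
  then show ?thesis using R by (simp add: tick_def field_simps)
qed

lemma tick_le_half:
  assumes "l < 4 * R * m"
  shows "tick m R l \<le> 1/2"
proof -
  have "0 \<le> 1 / (8 * real R)" by simp
  then show ?thesis using tick_bound[OF assms] by linarith
qed

lemma hard_job_release_bounds:
  assumes "r < block m R"
  shows "6 * real i \<le> fst (hard_job m R w i r) \<and> fst (hard_job m R w i r) \<le> 6 * real i + 6"
proof -
  have "tick m R (r - 2 * m) \<le> 1/2" if "\<not> r < 2 * m" "r < 2 * m + 4 * R * m"
    using that by (intro tick_le_half) auto
  moreover have "tick m R (r - (2 * m + 4 * R * m)) \<le> 1/2" if "\<not> r < 2 * m + 4 * R * m"
    using that assms by (intro tick_le_half) (auto simp: block_def algebra_simps)
  ultimately show ?thesis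
    using tick_nonneg[of m R "r - 2 * m"] tick_nonneg[of m R "r - (2 * m + 4 * R * m)"]
    unfolding hard_job_def first_stream_def by (cases "i \<in> w"; simp; linarith)
qed

lemma hard_job_release_mono:
  assumes "r \<le> r'" "r' < block m R"
  shows "fst (hard_job m R w i r) \<le> fst (hard_job m R w i r')"
proof -
  have "tick m R (r - 2 * m) \<le> 1/2" if "\<not> r < 2 * m" "r < 2 * m + 4 * R * m"
    using that by (intro tick_le_half) auto
  moreover have "tick m R (r - a) \<le> tick m R (r' - a)" for a
    using assms(1) by (intro tick_mono) auto
  ultimately show ?thesis
    using tick_nonneg[of m R "r' - 2 * m"] tick_nonneg[of m R "r' - (2 * m + 4 * R * m)"] assms(1)
    unfolding hard_job_def first_stream_def by (cases "i \<in> w"; simp; linarith)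
qed

lemma hard_job_proc_pos: "0 < R \<Longrightarrow> 0 < snd (hard_job m R w i r)"
  by (auto simp: hard_job_def)

lemma valid_hard_instance:
  assumes "0 < m" "0 < R" "R * block m R \<le> n"
  shows "valid_instance n (hard_instance m R w)"
proof -
  define B where "B = block m R"
  have B: "0 < B" using assms by (auto simp: B_def block_def)
  have rel: "fst (hard_instance m R w ! j) = fst (hard_job m R w (j div B) (j mod B))"
    if "j < R * B" for j using that nth_hard_instance by (simp add: B_def)
  have "sorted (map fst (hard_instance m R w))"
    unfolding sorted_iff_nth_mono
  proof (intro allI impI)
    fix j j' assume jj: "j \<le> j'" "j' < length (map fst (hard_instance m R w))"
    then have lt: "j < R * B" "j' < R * B" by (auto simp: B_def)
    have r: "j mod B < B" "j' mod B < B" using B by auto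
    have "fst (hard_job m R w (j div B) (j mod B)) \<le> fst (hard_job m R w (j' div B) (j' mod B))"
    proof (cases "j div B = j' div B")
      case True
      then have "j mod B \<le> j' mod B"
        using jj(1) by (metis add_le_cancel_left mult_div_mod_eq)
      then show ?thesis using r True hard_job_release_mono unfolding B_def by metis
    next
      case False
      then have "Suc (j div B) \<le> j' div B" using div_le_mono[OF jj(1), of B] by linarith
      then have "6 * real (j div B) + 6 \<le> 6 * real (j' div B)" by linarith
      moreover have "fst (hard_job m R w (j div B) (j mod B)) \<le> 6 * real (j div B) + 6"
        using r hard_job_release_bounds unfolding B_def by blast
      moreover have "6 * real (j' div B) \<le> fst (hard_job m R w (j' div B) (j' mod B))"
        using r hard_job_release_bounds unfolding B_def by blast
      ultimately show ?thesis by linarith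
    qed
    then show "map fst (hard_instance m R w) ! j \<le> map fst (hard_instance m R w) ! j'"
      using rel lt by (simp add: B_def)
  qed
  moreover have "0 \<le> fst x \<and> 0 < snd x" if x: "x \<in> set (hard_instance m R w)" for x
  proof -
    obtain j where j: "x = hard_job m R w (j div B) (j mod B)"
      using x unfolding hard_instance_def B_def by auto
    have "6 * real (j div B) \<le> fst (hard_job m R w (j div B) (j mod B))"
      using B hard_job_release_bounds[of "j mod B" m R] unfolding B_def by auto
    moreover have "0 \<le> 6 * real (j div B)" by simp
    ultimately show ?thesis
      using hard_job_proc_pos[OF assms(2)] unfolding j by (intro conjI) linarith+
  qed
  ultimately show ?thesis using assms(3) by (auto simp: valid_instance_def)
qed

lemma filter_map_upt_cong:
  assumes "\<And>j. j < n \<Longrightarrow> f j = g j \<or> \<not> P (f j) \<and> \<not> P (g j)"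
  shows "filter P (map f [0..<n]) = filter P (map g [0..<n])"
  using assms by (induction n) force+

text \<open>Bit \<open>i\<close> only shifts the first stream of round \<open>i\<close>, which
  starts no earlier than \<open>6 * i + 2\<close> for either value. Time \<open>6 * i + 1\<close> is
  thus late enough for a decision and too early for information.\<close>

lemma revealed_hard_instance:
  assumes "0 < m" "0 < R" "w - {i} = w' - {i}"
  shows "revealed (6 * real i + 1) (hard_instance m R w)
    = revealed (6 * real i + 1) (hard_instance m R w')"
  unfolding revealed_def hard_instance_def
proof (rule filter_map_upt_cong)
  fix j assume "j < R * block m R"
  define k r where "k = j div block m R" and "r = j mod block m R"
  have r: "r < block m R" using assms by (auto simp: r_def block_def)
  consider "k \<noteq> i" | "k = i" "r < 2 * m" | "k = i" "\<not> r < 2 * m" by blast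
  then have "hard_job m R w k r = hard_job m R w' k r \<or>
    6 * real i + 1 < fst (hard_job m R w k r) \<and> 6 * real i + 1 < fst (hard_job m R w' k r)"
  proof cases
    case 1
    then have "first_stream w k = first_stream w' k" using assms(3) by (auto simp: first_stream_def)
    then show ?thesis by (simp add: hard_job_def)
  next
    case 2
    then show ?thesis by (simp add: hard_job_def)
  next
    case 3
    then show ?thesis
      using tick_nonneg[of m R "r - 2 * m"] tick_nonneg[of m R "r - (2 * m + 4 * R * m)"]
      unfolding hard_job_def first_stream_def by (cases "i \<in> w"; cases "i \<in> w'"; simp; linarith)
  qed
  then show "hard_job m R w (j div block m R) (j mod block m R) =
         hard_job m R w' (j div block m R) (j mod block m R) \<or>
         \<not> (case hard_job m R w (j div block m R) (j mod block m R) of (r, p) \<Rightarrow> r \<le> 6 * real i + 1) \<and>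
         \<not> (case hard_job m R w' (j div block m R) (j mod block m R) of (r, p) \<Rightarrow> r \<le> 6 * real i + 1)"
    unfolding k_def[symmetric] r_def[symmetric] by (auto simp: case_prod_beta)
qed

subsection \<open>Long jobs and checkpoints\<close>

lemma sum_blocks:
  fixes f :: "nat \<Rightarrow> nat \<Rightarrow> 'a :: comm_monoid_add"
  assumes "0 < B"
  shows "(\<Sum>j<n * B. f (j div B) (j mod B)) = (\<Sum>i<n. \<Sum>r<B. f i r)"
proof -
  have "(\<Sum>j<n * B. f (j div B) (j mod B))
      = (\<Sum>i<n. \<Sum>j\<in>{i * B..<i * B + B}. f (j div B) (j mod B))"
    by (rule sum.nat_group[symmetric])
  also have "\<dots> = (\<Sum>i<n. \<Sum>r<B. f i r)"
  proof (rule sum.cong[OF refl])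
    fix i
    show "(\<Sum>j\<in>{i * B..<i * B + B}. f (j div B) (j mod B)) = (\<Sum>r<B. f i r)"
      using assms sum.atLeastLessThan_shift_0[of "\<lambda>j. f (j div B) (j mod B)" "i * B" "i * B + B"]
      by (simp add: lessThan_atLeast0)
  qed
  finally show ?thesis .
qed

definition long_job :: "nat \<Rightarrow> nat \<Rightarrow> nat \<Rightarrow> bool" where
  "long_job m R j \<longleftrightarrow> j < R * block m R \<and> j mod block m R < 2 * m"

lemma long_job_proc:
  "long_job m R j \<Longrightarrow> proc (hard_instance m R w) j = (if j mod block m R < m then 3 else 2)"
  by (auto simp: long_job_def nth_hard_instance hard_job_def)

lemma long_job_release:
  "long_job m R j \<Longrightarrow> release (hard_instance m R w) j = 6 * real (j div block m R)"
  by (auto simp: long_job_def nth_hard_instance hard_job_def)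

text \<open>Checkpoints lie \<open>1/8\<close> after the start of each stream: a long job completed across one
  occupies its machine for \<open>1/8\<close> within the first half of the stream.\<close>

definition checkpoint :: "nat \<Rightarrow> real" where
  "checkpoint i = 6 * real i - 3/8"

definition mid_checkpoint :: "nat set \<Rightarrow> nat \<Rightarrow> real" where
  "mid_checkpoint w i = first_stream w i + 1/8"

section \<open>Volume of completed long jobs, machine by machine\<close>

locale hard_schedule =
  fixes m R :: nat and w :: "nat set" and S :: schedule
  assumes m_pos: "0 < m" and R_pos: "0 < R"
    and schedule: "restart_schedule m (hard_instance m R w) S"
begin

abbreviation "J \<equiv> hard_instance m R w"

text \<open>Killed attempts are left out: they use up machine time but finish no volume.\<close>

definition long_runs :: "nat \<Rightarrow> run set" where
  "long_runs q = {x \<in> S. run_machine x = q \<and> long_job m R (run_job x) \<and> completes J x}"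

text \<open>A run is credited in full to the window in which it stops. Half-open windows that abut
  therefore share no run and miss none, at the price that work done before \<open>a\<close> may be
  counted.\<close>

definition window_runs :: "nat \<Rightarrow> real \<Rightarrow> real \<Rightarrow> run set" where
  "window_runs q a b = {x \<in> long_runs q. a < run_stop x \<and> run_stop x \<le> b}"

definition volume :: "nat \<Rightarrow> real \<Rightarrow> real \<Rightarrow> real" where
  "volume q a b = (\<Sum>x\<in>window_runs q a b. run_stop x - run_start x)"

definition crosses :: "nat \<Rightarrow> real \<Rightarrow> bool" where
  "crosses q c \<longleftrightarrow> (\<exists>x\<in>long_runs q. run_start x < c \<and> c < run_stop x)"

definition violated :: "nat \<Rightarrow> nat \<Rightarrow> bool" where
  "violated i q \<longleftrightarrow>
     crosses q (checkpoint i) \<or> crosses q (mid_checkpoint w i) \<or> crosses q (checkpoint (Suc i))"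

lemma block_pos: "0 < block m R"
  using m_pos by (simp add: block_def)

lemma long_run_length:
  "x \<in> long_runs q \<Longrightarrow>
    run_stop x - run_start x = (if run_job x mod block m R < m then 3 else 2)"
  using long_job_proc by (auto simp: long_runs_def completes_def)

lemma finite_window_runs: "finite (window_runs q a b)"
  by (rule finite_subset[OF _ finite_runs_stopped[OF schedule, of b]])
    (auto simp: window_runs_def long_runs_def)

lemma long_runs_disjoint:
  "x \<in> long_runs q \<Longrightarrow> y \<in> long_runs q \<Longrightarrow> x \<noteq> y \<Longrightarrow>
    run_stop x \<le> run_start y \<or> run_stop y \<le> run_start x"
  using run_disjoint[OF schedule] by (simp add: long_runs_def)

lemma volume_packing:
  assumes "lo \<le> b" and "\<And>x. x \<in> window_runs q a b \<Longrightarrow> lo \<le> run_start x"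
  shows "volume q a b \<le> b - lo"
  unfolding volume_def
proof (rule interval_packing)
  fix x assume x: "x \<in> window_runs q a b"
  then have "run_stop x - run_start x \<ge> 2"
    using long_run_length[of x q] by (auto simp: window_runs_def split: if_splits)
  then show "lo \<le> run_start x \<and> run_start x \<le> run_stop x \<and> run_stop x \<le> b"
    using x assms(2)[OF x] by (auto simp: window_runs_def)
next
  fix x y assume "x \<in> window_runs q a b" "y \<in> window_runs q a b" "x \<noteq> y"
  then show "run_stop x \<le> run_start y \<or> run_stop y \<le> run_start x"
    by (intro long_runs_disjoint[of x q y]) (auto simp: window_runs_def)
qed (use assms(1) finite_window_runs in auto)

text \<open>Only a run straddling \<open>a\<close> brings in outside work, and it is at most 3
  long.\<close>

lemma volume_le:
  assumes "a \<le> b"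
  shows "volume q a b \<le> b - a + 3"
proof -
  have "volume q a b \<le> b - (a - 3)"
  proof (rule volume_packing)
    fix x assume "x \<in> window_runs q a b"
    then show "a - 3 \<le> run_start x"
      using long_run_length[of x q] by (auto simp: window_runs_def split: if_splits)
  qed (use assms in simp)
  then show ?thesis by simp
qed

text \<open>If no run straddles \<open>a\<close>, all the credited work lies inside the
  window.\<close>

lemma volume_le_gap:
  assumes "a \<le> b" "\<not> crosses q a"
  shows "volume q a b \<le> b - a"
  using assms by (intro volume_packing) (auto simp: crosses_def window_runs_def)

lemma volume_split:
  assumes "a \<le> b" "b \<le> c"
  shows "volume q a c = volume q a b + volume q b c"
proof -
  have "window_runs q a c = window_runs q a b \<union> window_runs q b c"
    using assms by (auto simp: window_runs_def)
  moreover have "window_runs q a b \<inter> window_runs q b c = {}" by (auto simp: window_runs_def)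
  ultimately show ?thesis
    unfolding volume_def by (simp add: sum.union_disjoint finite_window_runs)
qed

text \<open>Integrality is the source of the lost unit. The two existence clauses allow passing back
  from a volume to a run of a known size; the first \<open>m\<close> positions of a block are the
  size-3 jobs.\<close>

lemma volume_eq:
  "\<exists>k l. volume q a b = real (3 * k + 2 * l) \<and>
    (0 < k \<longrightarrow> (\<exists>x\<in>window_runs q a b. run_job x mod block m R < m)) \<and>
    (0 < l \<longrightarrow> (\<exists>x\<in>window_runs q a b. \<not> run_job x mod block m R < m))"
proof -
  let ?W = "window_runs q a b"
  define A B where "A = {x \<in> ?W. run_job x mod block m R < m}"
    and "B = {x \<in> ?W. \<not> run_job x mod block m R < m}"
  have AB: "?W = A \<union> B" "A \<inter> B = {}" "finite A" "finite B"
    using finite_window_runs by (auto simp: A_def B_def)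
  have "volume q a b = (\<Sum>x\<in>A. 3) + (\<Sum>x\<in>B. 2)"
    unfolding volume_def AB(1) sum.union_disjoint[OF AB(3,4,2)]
    using long_run_length[of _ q]
    by (intro arg_cong2[where f = "(+)"] sum.cong) (auto simp: A_def B_def window_runs_def)
  then have "volume q a b = real (3 * card A + 2 * card B)" by simp
  moreover have "0 < card A \<longrightarrow> (\<exists>x\<in>?W. run_job x mod block m R < m)"
    by (auto simp: A_def card_gt_0_iff)
  moreover have "0 < card B \<longrightarrow> (\<exists>x\<in>?W. \<not> run_job x mod block m R < m)"
    by (auto simp: B_def card_gt_0_iff)
  ultimately show ?thesis by (intro exI conjI)
qed

text \<open>Of the sums \<open>3 * k + 2 * l\<close>, only 0, 2 and 3 are at most
  \<open>7/2\<close>; the value 3 needs a size-3 job.\<close>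

lemma volume_gap3:
  assumes "volume q a b \<le> 7/2"
  shows "volume q a b \<le> 3"
    and "2 < volume q a b \<Longrightarrow> \<exists>x\<in>window_runs q a b. run_job x mod block m R < m"
proof -
  obtain k l where kl: "volume q a b = real (3 * k + 2 * l)"
    "0 < k \<longrightarrow> (\<exists>x\<in>window_runs q a b. run_job x mod block m R < m)"
    using volume_eq[of q a b] by blast
  have "3 * k + 2 * l \<le> 3" using assms kl(1) by linarith
  then show "volume q a b \<le> 3" using kl(1) by linarith
  assume "2 < volume q a b"
  then have "2 < 3 * k + 2 * l" using kl(1) by linarith
  then have "0 < k" using \<open>3 * k + 2 * l \<le> 3\<close> by presburger
  then show "\<exists>x\<in>window_runs q a b. run_job x mod block m R < m" using kl(2) by blast
qed

text \<open>Only 0 and 2 are at most \<open>5/2\<close>, and a size-3 job does not fit at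
  all.\<close>

lemma volume_gap2:
  assumes "volume q a b \<le> 5/2"
  shows "volume q a b \<le> 2"
    and "1 < volume q a b \<Longrightarrow> \<exists>x\<in>window_runs q a b. \<not> run_job x mod block m R < m"
proof -
  obtain k l where kl: "volume q a b = real (3 * k + 2 * l)"
    "0 < l \<longrightarrow> (\<exists>x\<in>window_runs q a b. \<not> run_job x mod block m R < m)"
    using volume_eq[of q a b] by blast
  have "3 * k + 2 * l \<le> 2" using assms kl(1) by linarith
  then show "volume q a b \<le> 2" using kl(1) by linarith
  assume "1 < volume q a b"
  then have "1 < 3 * k + 2 * l" using kl(1) by linarith
  then have "0 < l" using \<open>3 * k + 2 * l \<le> 2\<close> by presburger
  then show "\<exists>x\<in>window_runs q a b. \<not> run_job x mod block m R < m" using kl(2) by blast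
qed

abbreviation "round_volume q i \<equiv> volume q (checkpoint i) (checkpoint (Suc i))"

lemma round_volume_le_9: "round_volume q i \<le> 9"
  using volume_le[of "checkpoint i" "checkpoint (Suc i)" q] by (simp add: checkpoint_def)

lemma round_volume_split:
  "round_volume q i
    = volume q (checkpoint i) (mid_checkpoint w i) + volume q (mid_checkpoint w i) (checkpoint (Suc i))"
  by (rule volume_split) (auto simp: checkpoint_def mid_checkpoint_def first_stream_def)

text \<open>Between consecutive checkpoints lie the last \<open>3/8\<close> of one stream, a gap,
  and the first \<open>1/8\<close> of the next stream: the gap length plus \<open>1/2\<close>. In
  round 0 the initial \<open>3/8\<close> is time before 0.\<close>

lemma gap_volumes:
  assumes "\<not> violated i q"
  shows "volume q (checkpoint i) (mid_checkpoint w i) \<le> (if i \<in> w then 7/2 else 5/2)"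
    and "volume q (mid_checkpoint w i) (checkpoint (Suc i)) \<le> (if i \<in> w then 5/2 else 7/2)"
  using volume_le_gap[of "checkpoint i" "mid_checkpoint w i" q]
    volume_le_gap[of "mid_checkpoint w i" "checkpoint (Suc i)" q] assms
  by (auto simp: violated_def checkpoint_def mid_checkpoint_def first_stream_def)

lemma round_volume_le_5:
  assumes "\<not> violated i q"
  shows "round_volume q i \<le> 5"
proof -
  let ?a = "volume q (checkpoint i) (mid_checkpoint w i)"
  let ?b = "volume q (mid_checkpoint w i) (checkpoint (Suc i))"
  have "?a \<le> (if i \<in> w then 3 else 2)" "?b \<le> (if i \<in> w then 2 else 3)"
    using gap_volumes[OF assms] volume_gap3(1) volume_gap2(1) by (auto split: if_splits)
  then show ?thesis unfolding round_volume_split by (auto split: if_splits)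
qed

text \<open>To lose no volume, a machine must match the jobs to the gaps, so the type of the gap can be
  read off the job that it runs one time unit into the round.\<close>

lemma full_round_run:
  assumes "\<not> violated i q" "4 < round_volume q i"
  shows "\<exists>x\<in>long_runs q. (run_job x mod block m R < m \<longleftrightarrow> i \<in> w)
    \<and> run_start x \<le> 6 * real i + 1 \<and> 6 * real i + 1 < run_stop x"
proof -
  have "\<exists>x\<in>window_runs q (checkpoint i) (mid_checkpoint w i). run_job x mod block m R < m \<longleftrightarrow> i \<in> w"
  proof (cases "i \<in> w")
    case True
    have "volume q (mid_checkpoint w i) (checkpoint (Suc i)) \<le> 2"
      using True gap_volumes(2)[OF assms(1)] volume_gap2(1) by simp
    then have "2 < volume q (checkpoint i) (mid_checkpoint w i)"
      using assms(2) unfolding round_volume_split by linarith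
    then show ?thesis using True gap_volumes(1)[OF assms(1)] volume_gap3(2) by simp
  next
    case False
    have "volume q (mid_checkpoint w i) (checkpoint (Suc i)) \<le> 3"
      using False gap_volumes(2)[OF assms(1)] volume_gap3(1) by simp
    then have "1 < volume q (checkpoint i) (mid_checkpoint w i)"
      using assms(2) unfolding round_volume_split by linarith
    then show ?thesis using False gap_volumes(1)[OF assms(1)] volume_gap2(2) by simp
  qed
  then obtain x where x: "x \<in> long_runs q" "checkpoint i < run_stop x" "run_stop x \<le> mid_checkpoint w i"
    "run_job x mod block m R < m \<longleftrightarrow> i \<in> w" by (auto simp: window_runs_def)
  \<comment> \<open>The run is confined to a window only \<open>1/2\<close> longer than itself, so
    it starts by \<open>6 * i + 1/8\<close> and is still running at
    \<open>6 * i + 1\<close>.\<close>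
  have "checkpoint i \<le> run_start x"
    using assms(1) x(1,2) by (auto simp: violated_def crosses_def)
  then have "run_start x \<le> 6 * real i + 1 \<and> 6 * real i + 1 < run_stop x"
    using long_run_length[OF x(1)] x(3,4)
    by (auto simp: checkpoint_def mid_checkpoint_def first_stream_def split: if_splits)
  then show ?thesis using x(1,4) by blast
qed

end

section \<open>Two instances with a common history\<close>

text \<open>An attempt still in progress is recorded with stop \<open>None\<close>. What carries
  over is that the machine is busy with this job at time \<open>t\<close>; the matching run in
  \<open>S'\<close> may still be killed later.\<close>

lemma running_of_history_eq:
  assumes "history t S = history t S'" "x \<in> S" "run_start x \<le> t" "t < run_stop x"
  shows "\<exists>y\<in>S'. run_job y = run_job x \<and> run_machine y = run_machine x
    \<and> run_start y = run_start x \<and> t < run_stop y"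
proof -
  have "(run_job x, run_machine x, run_start x, None) \<in> history t S"
    using assms(2-4) unfolding history_def by force
  then have "(run_job x, run_machine x, run_start x, None) \<in> history t S'" using assms(1) by simp
  then show ?thesis unfolding history_def by (auto split: if_splits)
qed

text \<open>If both volumes exceeded 4, machine \<open>q\<close> would be running a size-3 job at
  time \<open>6 * i + 1\<close> in one schedule and a size-2 job in the other, although their
  histories agree. So one volume is at most 4 and the other at most 5, on average \<open>9/2\<close>
  against the 5 released per machine.\<close>

lemma round_volume_pair:
  assumes "hard_schedule m R w S" "hard_schedule m R w' S'"
    and hist: "history (6 * real i + 1) S = history (6 * real i + 1) S'" and iw: "i \<in> w" "i \<notin> w'"
    and "\<not> hard_schedule.violated m R w S i q" "\<not> hard_schedule.violated m R w' S' i q"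
  shows "hard_schedule.volume m R w S q (checkpoint i) (checkpoint (Suc i))
    + hard_schedule.volume m R w' S' q (checkpoint i) (checkpoint (Suc i)) \<le> 9"
proof -
  interpret A: hard_schedule m R w S by fact
  interpret B: hard_schedule m R w' S' by fact
  have "A.round_volume q i \<le> 4 \<or> B.round_volume q i \<le> 4"
  proof (rule ccontr)
    assume "\<not> ?thesis"
    then obtain x y where x: "x \<in> A.long_runs q" "run_job x mod block m R < m"
        "run_start x \<le> 6 * real i + 1" "6 * real i + 1 < run_stop x"
      and y: "y \<in> B.long_runs q" "\<not> run_job y mod block m R < m"
        "run_start y \<le> 6 * real i + 1" "6 * real i + 1 < run_stop y"
      using A.full_round_run[of i q] B.full_round_run[of i q] assms by (auto simp: not_le)
    \<comment> \<open>\<open>z\<close> is the counterpart of \<open>y\<close> in \<open>S\<close>.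
      It need not complete there; occupying machine \<open>q\<close> together with \<open>x\<close>
      is already contradictory.\<close>
    obtain z where z: "z \<in> S" "run_job z = run_job y" "run_machine z = q"
      "run_start z \<le> 6 * real i + 1" "6 * real i + 1 < run_stop z"
      using running_of_history_eq[OF hist[symmetric], of y] y
      by (auto simp: B.long_runs_def)
    have "run_stop x \<le> run_start z \<or> run_stop z \<le> run_start x"
      using x(1,2) y(2) z by (intro run_disjoint[OF A.schedule]) (auto simp: A.long_runs_def)
    then show False using x z by linarith
  qed
  then show ?thesis
    using A.round_volume_le_5[OF assms(6)] B.round_volume_le_5[OF assms(7)] by linarith
qed

subsection \<open>The cost of a schedule\<close>

context hard_schedule
begin

definition crossings :: "real \<Rightarrow> nat" where
  "crossings c = card {q. q < m \<and> crosses q c}"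

definition violations :: "nat \<Rightarrow> nat" where
  "violations i = card {q. q < m \<and> violated i q}"

text \<open>The time \<open>6 * k + 45/8\<close> is \<open>checkpoint (Suc k)\<close>, written so
  that \<open>sum_flow_time_ge\<close> applies with period 6 and waiting time
  \<open>45/8\<close>.\<close>

definition unfinished :: "nat \<Rightarrow> nat" where
  "unfinished k = card {j. long_job m R j \<and> release J j \<le> 6 * real k
     \<and> \<not> completed_by J S (6 * real k + 45/8) j}"

text \<open>\<open>checkpoint 0\<close> lies before time 0, so no run crosses it. Removing this term
  matters because no stream surrounds it that could be charged.\<close>

lemma violations_le:
  "violations i \<le> (if i = 0 then 0 else crossings (checkpoint i))
    + crossings (mid_checkpoint w i) + crossings (checkpoint (Suc i))"
proof -
  have 0: "\<not> crosses q (checkpoint 0)" for q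
  proof
    assume "crosses q (checkpoint 0)"
    then obtain x where x: "x \<in> long_runs q" "run_start x < checkpoint 0" by (auto simp: crosses_def)
    then have "release J (run_job x) \<le> run_start x"
      using restart_scheduleD[OF schedule, of x] by (auto simp: long_runs_def)
    moreover have "0 \<le> release J (run_job x)" using x(1) long_job_release by (auto simp: long_runs_def)
    ultimately show False using x(2) by (simp add: checkpoint_def)
  qed
  have "violations i \<le> card ({q. q < m \<and> crosses q (checkpoint i)}
      \<union> {q. q < m \<and> crosses q (mid_checkpoint w i)} \<union> {q. q < m \<and> crosses q (checkpoint (Suc i))})"
    unfolding violations_def by (intro card_mono) (auto simp: violated_def)
  also have "\<dots> \<le> crossings (checkpoint i) + crossings (mid_checkpoint w i) + crossings (checkpoint (Suc i))"
    unfolding crossings_def by (meson add_le_mono card_Un_le le_refl order_trans)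
  finally show ?thesis using 0 by (auto simp: crossings_def)
qed

lemma volume_telescope:
  "volume q (checkpoint 0) (checkpoint (Suc k)) = (\<Sum>i\<le>k. round_volume q i)"
proof (induction k)
  case (Suc k)
  have "volume q (checkpoint 0) (checkpoint (Suc (Suc k)))
      = volume q (checkpoint 0) (checkpoint (Suc k)) + round_volume q (Suc k)"
    by (rule volume_split) (auto simp: checkpoint_def)
  then show ?case using Suc by simp
qed simp

text \<open>Each round releases volume \<open>5 * m\<close>. Whatever is not completed by the end of
  round \<open>k\<close> is spread over jobs of size at most 3.\<close>

lemma unfinished_ge:
  assumes k: "k < R"
  shows "(\<Sum>i\<le>k. 5 * real m - (\<Sum>q<m. round_volume q i)) \<le> 3 * real (unfinished k)"
proof -
  define B T where "B = block m R" and "T = checkpoint (Suc k)"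
  define I where "I = {j. long_job m R j \<and> j div B \<le> k}"
  define D where "D = {j \<in> I. completed_by J S T j}"
  define U where "U = (\<Union>q<m. window_runs q (checkpoint 0) T)"
  have B: "0 < B" "2 * m \<le> B" using block_pos by (auto simp: B_def block_def)
  have T: "T = 6 * real k + 45/8" by (simp add: T_def checkpoint_def)
  have "Suc k * B \<le> R * B" using k by (intro mult_right_mono) auto
  then have I_eq: "I = {j \<in> {..<Suc k * B}. j mod B < 2 * m}"
    using B(1) by (auto simp: I_def long_job_def B_def[symmetric] less_Suc_eq_le[symmetric]
      div_less_iff_less_mult)
  then have finI: "finite I" by simp
  \<comment> \<open>As a combination of indicators the size vanishes on the stream positions, so the
    sum extends to whole blocks and gives \<open>m + 2 * (2 * m) = 5 * m\<close> for each.\<close>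
  have procI: "proc J j = of_bool (j mod B < m) + 2 * of_bool (j mod B < 2 * m)" if "j \<in> I" for j
    using that long_job_proc[of m R j w] unfolding I_def B_def by (auto simp: long_job_def)
  have count: "(\<Sum>r<B. of_bool (r < a)) = real a" if "a \<le> B" for a
  proof -
    have "{..<B} \<inter> {r. r < a} = {..<a}" using that by auto
    then show ?thesis by (simp add: of_bool_def sum.If_cases)
  qed
  have "(\<Sum>j\<in>I. proc J j) = (\<Sum>j\<in>I. of_bool (j mod B < m) + 2 * of_bool (j mod B < 2 * m))"
    using procI by (intro sum.cong) auto
  also have "\<dots> = (\<Sum>j<Suc k * B. of_bool (j mod B < m) + 2 * of_bool (j mod B < 2 * m))"
    unfolding I_eq by (rule sum.mono_neutral_left) auto
  also have "\<dots> = (\<Sum>i<Suc k. \<Sum>r<B. of_bool (r < m) + 2 * of_bool (r < 2 * m))"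
    using sum_blocks[OF B(1), of "\<lambda>i r. of_bool (r < m) + 2 * of_bool (r < 2 * m)" "Suc k"] .
  also have "\<dots> = real (Suc k) * (5 * real m)"
    using count[of m] count[of "2 * m"] B(2) by (simp add: sum.distrib sum_distrib_left[symmetric])
  finally have total: "(\<Sum>j\<in>I. proc J j) = real (Suc k) * (5 * real m)" .
  have fin: "finite (window_runs q a b)" for q a b by (rule finite_window_runs)
  have "D \<subseteq> run_job ` U"
  proof
    fix j assume "j \<in> D"
    then obtain x where x: "x \<in> S" "run_job x = j" "completes J x" "run_stop x \<le> T" "long_job m R j"
      by (auto simp: D_def I_def completed_by_def)
    have "0 \<le> release J j" using x(5) long_job_release by simp
    then have "run_machine x < m \<and> checkpoint 0 < run_stop x"
      using restart_scheduleD[OF schedule x(1)] x(2) by (auto simp: checkpoint_def)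
    then show "j \<in> run_job ` U"
      using x by (auto simp: U_def window_runs_def long_runs_def)
  qed
  moreover have finU: "finite U" using fin by (simp add: U_def)
  moreover have pos: "0 \<le> proc J (run_job x)" if "x \<in> U" for x
    using that long_job_proc by (auto simp: U_def window_runs_def long_runs_def)
  ultimately have "(\<Sum>j\<in>D. proc J j) \<le> (\<Sum>j\<in>run_job ` U. proc J j)"
    by (intro sum_mono2) auto
  also have "\<dots> \<le> (\<Sum>x\<in>U. proc J (run_job x))"
    using sum_image_le[OF finU, of "proc J" run_job] pos by (simp add: o_def)
  also have "\<dots> = (\<Sum>q<m. \<Sum>x\<in>window_runs q (checkpoint 0) T. proc J (run_job x))"
    unfolding U_def using fin
    by (intro sum.UNION_disjoint) (auto simp: window_runs_def long_runs_def)
  also have "\<dots> = (\<Sum>q<m. volume q (checkpoint 0) T)"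
    unfolding volume_def
    by (intro sum.cong refl) (auto simp: window_runs_def long_runs_def completes_def)
  also have "\<dots> = (\<Sum>i\<le>k. \<Sum>q<m. round_volume q i)"
    unfolding T_def volume_telescope by (rule sum.swap)
  finally have done_le: "(\<Sum>j\<in>D. proc J j) \<le> (\<Sum>i\<le>k. \<Sum>q<m. round_volume q i)" .
  have "(\<Sum>j\<in>I. proc J j) - (\<Sum>j\<in>D. proc J j) = (\<Sum>j\<in>I - D. proc J j)"
    using finI by (intro sum_diff[symmetric]) (auto simp: D_def)
  also have "\<dots> \<le> (\<Sum>j\<in>I - D. 3)"
    using procI by (intro sum_mono) (auto simp: of_bool_def)
  also have "\<dots> = 3 * real (card (I - D))" by simp
  also have "I - D = {j. long_job m R j \<and> release J j \<le> 6 * real k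
     \<and> \<not> completed_by J S (6 * real k + 45/8) j}"
    using long_job_release by (auto simp: D_def I_def T B_def)
  finally show ?thesis
    using total done_le by (simp add: unfinished_def sum_subtractf)
qed

text \<open>Serves both streams of a round, which differ only in the offset \<open>b\<close> and the
  starting time \<open>g\<close>. A crossing run belongs to a long job and lasts at least 2, so it
  is a blocking run in the sense of \<open>stream_delay\<close>.\<close>

lemma crossings_delay:
  assumes g: "0 \<le> g" and i: "i < R" and b: "2 * m \<le> b" "b + 4 * R * m \<le> block m R"
    and stream: "\<And>l. l < 4 * R * m \<Longrightarrow> hard_job m R w i (b + l) = (g + tick m R l, 1 / (8 * real R))"
  shows "ennreal (real (crossings (g + 1/8)) * real R / 4)
    \<le> (\<Sum>j\<in>{i * block m R + b..<i * block m R + b + 4 * R * m}. flow_time J S j)"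
  unfolding crossings_def
proof (rule stream_delay[OF schedule m_pos R_pos g])
  have idx: "(i * block m R + b + l) div block m R = i \<and> (i * block m R + b + l) mod block m R = b + l
    \<and> i * block m R + b + l < R * block m R" if "l < 4 * R * m" for l
  proof -
    have "b + l < block m R" using that b by linarith
    moreover have "Suc i * block m R \<le> R * block m R" using i by (intro mult_right_mono) auto
    ultimately show ?thesis using block_pos by (simp add: add.assoc)
  qed
  show "J ! (i * block m R + b + l) = (g + real (l div m) / (8 * real R), 1 / (8 * real R))"
    if "l < 4 * R * m" for l
    using idx[OF that] stream[OF that] by (simp add: nth_hard_instance tick_def)
  fix q assume "q \<in> {q. q < m \<and> crosses q (g + 1/8)}"
  then obtain x where x: "x \<in> long_runs q" "run_start x < g + 1/8" "g + 1/8 < run_stop x"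
    by (auto simp: crosses_def)
  have "run_job x \<notin> {i * block m R + b..<i * block m R + b + 4 * R * m}"
  proof
    assume a: "run_job x \<in> {i * block m R + b..<i * block m R + b + 4 * R * m}"
    define l where "l = run_job x - (i * block m R + b)"
    have "run_job x = i * block m R + b + l" "l < 4 * R * m" using a by (auto simp: l_def)
    then show False using idx[of l] x(1) b(1) by (auto simp: long_runs_def long_job_def)
  qed
  moreover have "run_start x + 1/4 \<le> run_stop x"
    using long_run_length[OF x(1)] by (auto split: if_splits)
  ultimately show "\<exists>x\<in>S. run_machine x = q
      \<and> run_job x \<notin> {i * block m R + b..<i * block m R + b + 4 * R * m}
      \<and> run_start x < g + 1/8 \<and> g + 1/8 < run_stop x \<and> run_start x + 1/4 \<le> run_stop x"
    using x by (auto simp: long_runs_def)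
qed auto

text \<open>The charges fall on disjoint positions of each block (long jobs, first stream, second
  stream) and hence add up. A crossing of \<open>checkpoint (Suc i)\<close> is charged to the second
  stream of round \<open>i\<close>.\<close>

lemma total_flow_ge:
  "ennreal (45/8 * (\<Sum>k<R. real (unfinished k))
      + real R / 4 * (\<Sum>i<R. real (crossings (mid_checkpoint w i) + crossings (checkpoint (Suc i)))))
    \<le> total_flow_time J S"
proof -
  define B where "B = block m R"
  define F where "F = flow_time J S"
  define b where "b = 2 * m + 4 * R * m"
  have B: "B = b + 4 * R * m" "0 < B" using m_pos by (auto simp: B_def b_def block_def algebra_simps)
  have long: "ennreal (45/8 * (\<Sum>k<R. real (unfinished k))) \<le> (\<Sum>j\<in>{j. long_job m R j}. F j)"
    unfolding F_def
  proof (rule sum_flow_time_ge[OF schedule, where h = 6 and a = 0])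
    show "finite {j. long_job m R j}"
      by (rule finite_subset[of _ "{..<R * block m R}"]) (auto simp: long_job_def)
  qed (auto simp: long_job_release unfinished_def)
  have "{j. long_job m R j} = {j \<in> {..<R * B}. j mod B < 2 * m}"
    by (auto simp: long_job_def B_def)
  then have "(\<Sum>j\<in>{j. long_job m R j}. F j) = (\<Sum>j<R * B. if j mod B < 2 * m then F j else 0)"
    by (simp only: sum.inter_filter[OF finite_lessThan])
  also have "\<dots> = (\<Sum>i<R. \<Sum>j\<in>{i * B..<i * B + B}. if j mod B < 2 * m then F j else 0)"
    by (rule sum.nat_group[symmetric])
  also have "\<dots> = (\<Sum>i<R. \<Sum>j\<in>{i * B..<i * B + 2 * m}. F j)"
  proof (rule sum.cong[OF refl])
    fix i
    have mod: "(i * B + l) mod B = l" if "l < B" for l using that by simp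
    have "j mod B < 2 * m \<longleftrightarrow> j < i * B + 2 * m" if j: "j \<in> {i * B..<i * B + B}" for j
    proof -
      obtain l where "j = i * B + l" "l < B" using j by (auto dest!: le_Suc_ex)
      then show ?thesis using mod[of l] by simp
    qed
    then have "{j \<in> {i * B..<i * B + B}. j mod B < 2 * m} = {i * B..<i * B + 2 * m}"
      using B(1) by (auto simp: b_def)
    then show "(\<Sum>j\<in>{i * B..<i * B + B}. if j mod B < 2 * m then F j else 0)
        = (\<Sum>j\<in>{i * B..<i * B + 2 * m}. F j)"
      using sum.inter_filter[of "{i * B..<i * B + B}" F "\<lambda>j. j mod B < 2 * m"] by simp
  qed
  finally have long_eq: "(\<Sum>j\<in>{j. long_job m R j}. F j) = (\<Sum>i<R. \<Sum>j\<in>{i * B..<i * B + 2 * m}. F j)" .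
  have streams: "ennreal (real R / 4 * real (crossings (mid_checkpoint w i) + crossings (checkpoint (Suc i))))
      \<le> (\<Sum>j\<in>{i * B + 2 * m..<i * B + B}. F j)" if i: "i < R" for i
  proof -
    have "ennreal (real (crossings (mid_checkpoint w i)) * real R / 4)
        \<le> (\<Sum>j\<in>{i * B + 2 * m..<i * B + 2 * m + 4 * R * m}. F j)"
      unfolding mid_checkpoint_def B_def F_def
      by (rule crossings_delay[OF _ i])
        (auto simp: first_stream_def hard_job_def block_def algebra_simps)
    moreover have "ennreal (real (crossings (checkpoint (Suc i))) * real R / 4)
        \<le> (\<Sum>j\<in>{i * B + b..<i * B + b + 4 * R * m}. F j)"
    proof -
      have "checkpoint (Suc i) = (6 * real i + 11/2) + 1/8" by (simp add: checkpoint_def)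
      then show ?thesis
        unfolding B_def F_def
        by (simp only:, intro crossings_delay[OF _ i])
          (auto simp: hard_job_def b_def block_def algebra_simps)
    qed
    ultimately have "ennreal (real (crossings (mid_checkpoint w i)) * real R / 4)
        + ennreal (real (crossings (checkpoint (Suc i))) * real R / 4)
        \<le> (\<Sum>j\<in>{i * B + 2 * m..<i * B + b}. F j) + (\<Sum>j\<in>{i * B + b..<i * B + B}. F j)"
      by (intro add_mono) (auto simp: B b_def algebra_simps)
    also have "\<dots> = (\<Sum>j\<in>{i * B + 2 * m..<i * B + B}. F j)"
      by (rule sum.atLeastLessThan_concat) (auto simp: B b_def)
    finally show ?thesis
      by (simp add: ennreal_plus[symmetric] algebra_simps add_divide_distrib del: ennreal_plus)
  qed
  have "ennreal (45/8 * (\<Sum>k<R. real (unfinished k))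
      + real R / 4 * (\<Sum>i<R. real (crossings (mid_checkpoint w i) + crossings (checkpoint (Suc i)))))
    = ennreal (45/8 * (\<Sum>k<R. real (unfinished k)))
      + (\<Sum>i<R. ennreal (real R / 4 * real (crossings (mid_checkpoint w i) + crossings (checkpoint (Suc i)))))"
    by (simp add: sum_distrib_left sum_nonneg sum_ennreal)
  also have "\<dots> \<le> (\<Sum>i<R. \<Sum>j\<in>{i * B..<i * B + 2 * m}. F j) + (\<Sum>i<R. \<Sum>j\<in>{i * B + 2 * m..<i * B + B}. F j)"
    using long streams unfolding long_eq by (intro add_mono sum_mono) auto
  also have "\<dots> = (\<Sum>i<R. \<Sum>j\<in>{i * B..<i * B + B}. F j)"
    unfolding sum.distrib[symmetric]
    by (intro sum.cong refl sum.atLeastLessThan_concat) (auto simp: B b_def)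
  also have "\<dots> = (\<Sum>j<R * B. F j)" by (rule sum.nat_group)
  also have "\<dots> = total_flow_time J S" by (simp add: total_flow_time_def F_def B_def)
  finally show ?thesis .
qed

end

subsection \<open>Averaging over the instances\<close>

text \<open>Without violations an average round loses volume \<open>m / 2\<close>, so backlogs grow
  linearly and sum to order \<open>m * R^2\<close>. A violation offsets at most 9 units, felt in at
  most \<open>R\<close> later backlogs, while the stream terms weigh each crossing with
  \<open>R / 4\<close>. Hence neither few nor many violations make the total cheap.\<close>

lemma backlog_average:
  fixes vol viol U Z :: "'a \<Rightarrow> nat \<Rightarrow> real" and m :: real
  assumes "finite P" "0 \<le> m"
    and U: "\<And>v k. v \<in> P \<Longrightarrow> k < R \<Longrightarrow> (\<Sum>i\<le>k. 5 * m - vol v i) \<le> 3 * U v k"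
    and Z: "\<And>v. v \<in> P \<Longrightarrow> (\<Sum>i<R. viol v i) \<le> 2 * (\<Sum>i<R. Z v i)"
    and vol: "\<And>i. i < R \<Longrightarrow> (\<Sum>v\<in>P. vol v i) \<le> real (card P) * (9/2 * m) + 9 * (\<Sum>v\<in>P. viol v i)"
    and nonneg: "\<And>v i. 0 \<le> viol v i" "\<And>v k. 0 \<le> U v k"
  shows "real (card P) * m * (real R)\<^sup>2 / 300
    \<le> (\<Sum>v\<in>P. 45/8 * (\<Sum>k<R. U v k) + real R / 4 * (\<Sum>i<R. Z v i))"
proof -
  define N where "N = real (card P) * m"
  define V where "V = (\<Sum>v\<in>P. \<Sum>i<R. viol v i)"
  define SU where "SU = (\<Sum>v\<in>P. \<Sum>k<R. U v k)"
  define SZ where "SZ = (\<Sum>v\<in>P. \<Sum>i<R. Z v i)"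
  define x where "x i = (\<Sum>v\<in>P. viol v i)" for i
  have x0: "0 \<le> x i" for i unfolding x_def by (intro sum_nonneg nonneg)
  have V: "V = (\<Sum>i<R. x i)" unfolding V_def x_def by (rule sum.swap)
  have SU0: "0 \<le> SU" unfolding SU_def by (intro sum_nonneg nonneg)
  have "(\<Sum>k<R. \<Sum>i\<le>k. N / 2 - 9 * x i) \<le> (\<Sum>k<R. \<Sum>i\<le>k. \<Sum>v\<in>P. 5 * m - vol v i)"
  proof (intro sum_mono)
    fix k i assume "k \<in> {..<R}" "i \<in> {..k}"
    then have "i < R" by simp
    from vol[OF this] show "N / 2 - 9 * x i \<le> (\<Sum>v\<in>P. 5 * m - vol v i)"
      by (simp add: sum_subtractf N_def x_def)
  qed
  also have "\<dots> = (\<Sum>k<R. \<Sum>v\<in>P. \<Sum>i\<le>k. 5 * m - vol v i)"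
    by (intro sum.cong refl sum.swap)
  also have "\<dots> = (\<Sum>v\<in>P. \<Sum>k<R. \<Sum>i\<le>k. 5 * m - vol v i)" by (rule sum.swap)
  also have "\<dots> \<le> (\<Sum>v\<in>P. \<Sum>k<R. 3 * U v k)" using U by (intro sum_mono) auto
  also have "\<dots> = 3 * SU" by (simp add: SU_def sum_distrib_left)
  finally have 1: "(\<Sum>k<R. \<Sum>i\<le>k. N / 2 - 9 * x i) \<le> 3 * SU" .
  have "(\<Sum>k<R. \<Sum>i\<le>k. x i) \<le> (\<Sum>k<R. V)"
    unfolding V using x0 by (intro sum_mono sum_mono2) auto
  then have "(\<Sum>k<R. \<Sum>i\<le>k. x i) \<le> real R * V" by simp
  moreover have "(\<Sum>k<R. \<Sum>i\<le>k. N / 2 - 9 * x i)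
      = (\<Sum>k<R. real k + 1) * (N / 2) - 9 * (\<Sum>k<R. \<Sum>i\<le>k. x i)"
    by (simp add: sum_subtractf sum_distrib_left sum_distrib_right sum_divide_distrib algebra_simps)
  moreover have "(real R)\<^sup>2 / 2 * (N / 2) \<le> (\<Sum>k<R. real k + 1) * (N / 2)"
  proof (rule mult_right_mono)
    show "(real R)\<^sup>2 / 2 \<le> (\<Sum>k<R. real k + 1)"
      by (induction R) (simp_all add: power2_eq_square algebra_simps)
    show "0 \<le> N / 2" using assms(2) by (simp add: N_def)
  qed
  ultimately have 2: "(real R)\<^sup>2 / 2 * (N / 2) - 9 * (real R * V) \<le> 3 * SU" using 1 by linarith
  have "V \<le> (\<Sum>v\<in>P. 2 * (\<Sum>i<R. Z v i))" unfolding V_def by (intro sum_mono Z)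
  then have "V \<le> 2 * SZ" by (simp add: SZ_def sum_distrib_left)
  then have "real R * V \<le> real R * (2 * SZ)" by (intro mult_left_mono) auto
  then have 3: "real R * V \<le> 2 * (real R * SZ)" by (simp only: mult.left_commute)
  have "0 \<le> V" unfolding V using x0 by (intro sum_nonneg)
  then have 4: "0 \<le> real R * V" by simp
  have "(\<Sum>v\<in>P. 45/8 * (\<Sum>k<R. U v k) + real R / 4 * (\<Sum>i<R. Z v i)) = 45/8 * SU + (real R * SZ) / 4"
    unfolding sum.distrib SU_def SZ_def sum_distrib_left[symmetric] by simp
  moreover have "real (card P) * m * (real R)\<^sup>2 = 4 * ((real R)\<^sup>2 / 2 * (N / 2))" by (simp add: N_def)
  \<comment> \<open>With \<open>X = card P * m * R^2\<close>, the facts give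
    \<open>X / 4 \<le> 3 * SU + 18 * R * SZ\<close>. The right side is at most 72 times the cost,
    which yields \<open>X / 288\<close>; 300 is a rounding.\<close>
  ultimately show ?thesis using 2 3 4 SU0 by linarith
qed

context hard_schedule
begin

text \<open>A checkpoint between two rounds is counted by both of them, a middle checkpoint by one
  only; hence the factor 2.\<close>

lemma sum_violations_le:
  "(\<Sum>i<R. real (violations i))
    \<le> 2 * (\<Sum>i<R. real (crossings (mid_checkpoint w i) + crossings (checkpoint (Suc i))))"
proof -
  define Y where "Y i = real (crossings (checkpoint i))" for i
  have "(\<Sum>i<R. real (violations i))
      \<le> (\<Sum>i<R. (if i = 0 then 0 else Y i) + (real (crossings (mid_checkpoint w i)) + Y (Suc i)))"
  proof (rule sum_mono)
    fix i
    have "real (violations i) \<le> real ((if i = 0 then 0 else crossings (checkpoint i))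
      + crossings (mid_checkpoint w i) + crossings (checkpoint (Suc i)))"
      using violations_le by (subst of_nat_le_iff) simp
    then show "real (violations i)
        \<le> (if i = 0 then 0 else Y i) + (real (crossings (mid_checkpoint w i)) + Y (Suc i))"
      by (auto simp: Y_def)
  qed
  also have "\<dots> = (\<Sum>i<R. if i = 0 then 0 else Y i) + (\<Sum>i<R. real (crossings (mid_checkpoint w i)) + Y (Suc i))"
    by (rule sum.distrib)
  also have "(\<Sum>i<R. if i = 0 then 0 else Y i) \<le> (\<Sum>i<R. real (crossings (mid_checkpoint w i)) + Y (Suc i))"
  proof (cases R)
    case (Suc k)
    have "(\<Sum>i<Suc k. if i = 0 then 0 else Y i) = (\<Sum>i<k. Y (Suc i))"
      by (simp add: sum.lessThan_Suc_shift del: sum.lessThan_Suc)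
    also have "\<dots> \<le> (\<Sum>i<Suc k. Y (Suc i))" by (simp add: Y_def)
    also have "\<dots> \<le> (\<Sum>i<Suc k. real (crossings (mid_checkpoint w i)) + Y (Suc i))"
      by (intro sum_mono) simp
    finally show ?thesis using Suc by simp
  qed simp
  finally show ?thesis by (simp add: Y_def)
qed

end

lemma hard_schedule_of_online:
  assumes "online_algorithm n m A" "0 < m" "0 < R" "R * block m R \<le> n"
  shows "hard_schedule m R w (A (hard_instance m R w))"
  using assms valid_hard_instance[of m R n w]
  by unfold_locales (auto simp: online_algorithm_def)

text \<open>Toggling bit \<open>i\<close> of \<open>w\<close> pairs up the instances that agree until one time unit into round \<open>i\<close>.\<close>

lemma sum_round_volume_le:
  fixes A :: "job list \<Rightarrow> schedule"
  assumes A: "online_algorithm n m A" and m: "0 < m" and R: "0 < R"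
    and n: "R * block m R \<le> n" and i: "i < R"
  defines "S \<equiv> \<lambda>w. A (hard_instance m R w)"
  shows "(\<Sum>w\<in>Pow {..<R}. \<Sum>q<m. hard_schedule.volume m R w (S w) q (checkpoint i) (checkpoint (Suc i)))
    \<le> 2 ^ R * (9/2 * real m)
      + 9 * (\<Sum>w\<in>Pow {..<R}. real (hard_schedule.violations m R w (S w) i))"
proof -
  define P where "P = Pow {..<R}"
  define flip where "flip w = (if i \<in> w then w - {i} else insert i w)" for w
  define vol where "vol w q = hard_schedule.volume m R w (S w) q (checkpoint i) (checkpoint (Suc i))" for w q
  define bad where "bad w q = hard_schedule.violated m R w (S w) i q" for w q
  define viol where "viol w = real (hard_schedule.violations m R w (S w) i)" for w
  have H: "hard_schedule m R w (S w)" for w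
    unfolding S_def by (rule hard_schedule_of_online[OF A m R n])
  have hist: "history (6 * real i + 1) (S w) = history (6 * real i + 1) (S (flip w))" for w
  proof -
    have "w - {i} = flip w - {i}" by (auto simp: flip_def)
    then have "revealed (6 * real i + 1) (hard_instance m R w)
        = revealed (6 * real i + 1) (hard_instance m R (flip w))"
      by (rule revealed_hard_instance[OF m R])
    moreover have "valid_instance n (hard_instance m R v)" for v
      by (rule valid_hard_instance[OF m R n])
    ultimately show ?thesis using A unfolding online_algorithm_def S_def by blast
  qed
  \<comment> \<open>If neither side violates, the bound is \<open>5 + 4\<close>. Otherwise each
    volume is at most \<open>6 + 3 = 9\<close>, and a single violation already pays for the excess
    of 9.\<close>
  have pair: "vol w q + vol (flip w) q \<le> 9 + 9 * (of_bool (bad w q) + of_bool (bad (flip w) q))" for w q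
  proof -
    have 9: "vol v q \<le> 9" for v unfolding vol_def by (rule hard_schedule.round_volume_le_9[OF H])
    have "vol w q + vol (flip w) q \<le> 9" if "\<not> bad w q" "\<not> bad (flip w) q"
    proof (cases "i \<in> w")
      case True
      then show ?thesis
        using round_volume_pair[OF H H hist, of w q] that unfolding vol_def bad_def
        by (simp add: flip_def)
    next
      case False
      then show ?thesis
        using round_volume_pair[OF H H hist[symmetric], of w q] that unfolding vol_def bad_def
        by (simp add: flip_def)
    qed
    then show ?thesis using 9[of w] 9[of "flip w"] by (cases "bad w q"; cases "bad (flip w) q") auto
  qed
  have viol: "(\<Sum>q<m. of_bool (bad w q)) = viol w" for w
  proof -
    have "{..<m} \<inter> {q. bad w q} = {q. q < m \<and> hard_schedule.violated m R w (S w) i q}"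
      by (auto simp: bad_def)
    then show ?thesis
      by (simp add: viol_def hard_schedule.violations_def[OF H] of_bool_def sum.If_cases)
  qed
  have bij: "bij_betw flip P P"
    by (rule bij_betwI[where g = flip]) (use i in \<open>auto simp: flip_def P_def split: if_splits\<close>)
  have "2 * (\<Sum>w\<in>P. \<Sum>q<m. vol w q) = (\<Sum>w\<in>P. \<Sum>q<m. vol w q) + (\<Sum>w\<in>P. \<Sum>q<m. vol (flip w) q)"
    using sum.reindex_bij_betw[OF bij, of "\<lambda>w. \<Sum>q<m. vol w q"] by simp
  also have "\<dots> = (\<Sum>w\<in>P. \<Sum>q<m. vol w q + vol (flip w) q)" by (simp add: sum.distrib)
  also have "\<dots> \<le> (\<Sum>w\<in>P. \<Sum>q<m. 9 + 9 * (of_bool (bad w q) + of_bool (bad (flip w) q)))"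
    by (intro sum_mono pair)
  also have "\<dots> = (\<Sum>w\<in>P. 9 * real m + 9 * (viol w + viol (flip w)))"
    by (simp add: sum.distrib sum_distrib_left[symmetric] viol)
  also have "\<dots> = real (card P) * (9 * real m) + 9 * ((\<Sum>w\<in>P. viol w) + (\<Sum>w\<in>P. viol (flip w)))"
    by (simp add: sum.distrib sum_distrib_left[symmetric])
  also have "(\<Sum>w\<in>P. viol (flip w)) = (\<Sum>w\<in>P. viol w)"
    by (rule sum.reindex_bij_betw[OF bij])
  also have "real (card P) = 2 ^ R" by (simp add: P_def card_Pow)
  finally show ?thesis unfolding P_def vol_def viol_def by simp
qed

text \<open>Summing over all \<open>2 ^ R\<close> sets plays the role of independent fair bits. The
  bound holds for every deterministic algorithm, so it survives integration over a distribution of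
  them.\<close>

lemma online_average_cost:
  assumes A: "online_algorithm n m A" and m: "0 < m" and R: "0 < R" and n: "R * block m R \<le> n"
  shows "ennreal (2 ^ R * real m * (real R)\<^sup>2 / 300)
    \<le> (\<Sum>w\<in>Pow {..<R}. total_flow_time (hard_instance m R w) (A (hard_instance m R w)))"
proof -
  define P where "P = Pow {..<R}"
  define S where "S w = A (hard_instance m R w)" for w
  have H: "hard_schedule m R w (S w)" for w
    unfolding S_def by (rule hard_schedule_of_online[OF A m R n])
  define U where "U w k = real (hard_schedule.unfinished m R w (S w) k)" for w k
  define Z where "Z w i = real (hard_schedule.crossings m R w (S w) (mid_checkpoint w i)
    + hard_schedule.crossings m R w (S w) (checkpoint (Suc i)))" for w i
  have P: "finite P" "real (card P) = 2 ^ R" by (auto simp: P_def card_Pow)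
  have "2 ^ R * real m * (real R)\<^sup>2 / 300
      \<le> (\<Sum>w\<in>P. 45/8 * (\<Sum>k<R. U w k) + real R / 4 * (\<Sum>i<R. Z w i))"
    unfolding P(2)[symmetric]
  proof (rule backlog_average[OF P(1),
      where viol = "\<lambda>w i. real (hard_schedule.violations m R w (S w) i)"
        and vol = "\<lambda>w i. \<Sum>q<m. hard_schedule.volume m R w (S w) q (checkpoint i) (checkpoint (Suc i))"])
    show "(\<Sum>i\<le>k. 5 * real m
        - (\<Sum>q<m. hard_schedule.volume m R w (S w) q (checkpoint i) (checkpoint (Suc i)))) \<le> 3 * U w k"
      if "k < R" for w k
      unfolding U_def by (rule hard_schedule.unfinished_ge[OF H that])
    show "(\<Sum>i<R. real (hard_schedule.violations m R w (S w) i)) \<le> 2 * (\<Sum>i<R. Z w i)" for w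
      unfolding Z_def by (rule hard_schedule.sum_violations_le[OF H])
    show "(\<Sum>w\<in>P. \<Sum>q<m. hard_schedule.volume m R w (S w) q (checkpoint i) (checkpoint (Suc i)))
        \<le> real (card P) * (9/2 * real m) + 9 * (\<Sum>w\<in>P. real (hard_schedule.violations m R w (S w) i))"
      if "i < R" for i
      unfolding P(2) unfolding P_def S_def by (rule sum_round_volume_le[OF A m R n that])
  qed (auto simp: U_def)
  then have "ennreal (2 ^ R * real m * (real R)\<^sup>2 / 300)
      \<le> ennreal (\<Sum>w\<in>P. 45/8 * (\<Sum>k<R. U w k) + real R / 4 * (\<Sum>i<R. Z w i))"
    by (rule ennreal_leI)
  also have "\<dots> = (\<Sum>w\<in>P. ennreal (45/8 * (\<Sum>k<R. U w k) + real R / 4 * (\<Sum>i<R. Z w i)))"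
    by (intro sum_ennreal[symmetric]) (auto simp: U_def Z_def intro!: add_nonneg_nonneg mult_nonneg_nonneg sum_nonneg)
  also have "\<dots> \<le> (\<Sum>w\<in>P. total_flow_time (hard_instance m R w) (S w))"
    unfolding U_def Z_def by (intro sum_mono hard_schedule.total_flow_ge[OF H])
  finally show ?thesis by (simp add: P_def S_def)
qed

subsection \<open>The offline optimum\<close>

text \<open>The offsets \<open>5/2\<close> and \<open>7/2\<close> are the ends of the first stream
  after a short and a long first gap, where the second gap opens. Tiny jobs start on
  release.\<close>

definition offline_start :: "nat \<Rightarrow> nat \<Rightarrow> nat set \<Rightarrow> nat \<Rightarrow> nat \<Rightarrow> real" where
  "offline_start m R w i r =
     (if r < m then 6 * real i + (if i \<in> w then 0 else 5/2)
      else if r < 2 * m then 6 * real i + (if i \<in> w then 7/2 else 0)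
      else fst (hard_job m R w i r))"

definition offline_stop :: "nat \<Rightarrow> nat \<Rightarrow> nat set \<Rightarrow> nat \<Rightarrow> nat \<Rightarrow> real" where
  "offline_stop m R w i r = offline_start m R w i r + snd (hard_job m R w i r)"

lemma block_position_cases:
  assumes "r < block m R"
  obtains "r < m" | "\<not> r < m" "r < 2 * m"
  | "\<not> r < 2 * m" "r < 2 * m + 4 * R * m" "tick m R (r - 2 * m) + 1 / (8 * real R) \<le> 1/2"
  | "\<not> r < 2 * m + 4 * R * m" "tick m R (r - (2 * m + 4 * R * m)) + 1 / (8 * real R) \<le> 1/2"
proof -
  have "tick m R (r - 2 * m) + 1 / (8 * real R) \<le> 1/2" if "\<not> r < 2 * m" "r < 2 * m + 4 * R * m"
    using that by (intro tick_bound) auto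
  moreover have "tick m R (r - (2 * m + 4 * R * m)) + 1 / (8 * real R) \<le> 1/2"
    if "\<not> r < 2 * m + 4 * R * m"
    using that assms by (intro tick_bound) (auto simp: block_def algebra_simps)
  ultimately show thesis using that by blast
qed

lemma offline_bounds:
  assumes "r < block m R"
  shows "6 * real i \<le> fst (hard_job m R w i r) \<and>
    fst (hard_job m R w i r) \<le> offline_start m R w i r \<and> offline_stop m R w i r \<le> 6 * real i + 6"
  using assms
proof (cases rule: block_position_cases)
  case 3
  then show ?thesis using tick_nonneg[of m R "r - 2 * m"]
    by (auto simp: offline_start_def offline_stop_def hard_job_def first_stream_def)
next
  case 4
  then show ?thesis using tick_nonneg[of m R "r - (2 * m + 4 * R * m)"]
    by (auto simp: offline_start_def offline_stop_def hard_job_def first_stream_def)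
qed (auto simp: offline_start_def offline_stop_def hard_job_def first_stream_def)

text \<open>Positions congruent modulo \<open>m\<close> share a machine. Two long jobs among them
  have different sizes and so use different gaps; two jobs of one stream belong to different
  ticks.\<close>

lemma offline_disjoint_round:
  assumes rr: "r < r'" "r' < block m R" and mod: "r mod m = r' mod m" and m: "0 < m" and R: "0 < R"
  shows "offline_stop m R w i r \<le> offline_start m R w i r' \<or>
    offline_stop m R w i r' \<le> offline_start m R w i r"
proof -
  have tick_step: "tick m R (r - a) + 1 / (8 * real R) \<le> tick m R (r' - a)"
    if a: "a \<le> r" "m dvd a" for a
  proof -
    have shift: "(k - a) mod m = k mod m" if "a \<le> k" for k
    proof -
      have "k mod m = (k - a + a) mod m" using that by simp
      also have "\<dots> = (k - a) mod m" using a(2) by (metis add.right_neutral dvd_imp_mod_0 mod_add_right_eq)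
      finally show ?thesis by simp
    qed
    have "(r - a) mod m = (r' - a) mod m" using shift[of r] shift[of r'] a(1) rr(1) mod by simp
    moreover have "r - a < r' - a" using a rr(1) by simp
    ultimately have "(r - a) div m < (r' - a) div m"
      by (metis div_le_mono less_imp_le mult_div_mod_eq nat_less_le)
    then have "real ((r - a) div m) + 1 \<le> real ((r' - a) div m)" by linarith
    then have "(real ((r - a) div m) + 1) / (8 * real R) \<le> real ((r' - a) div m) / (8 * real R)"
      by (rule divide_right_mono) simp
    then show ?thesis by (simp add: tick_def add_divide_distrib)
  qed
  have lt: "r < block m R" using rr by simp
  note defs = offline_start_def offline_stop_def hard_job_def first_stream_def
  from lt show ?thesis
  proof (cases rule: block_position_cases)
    case 1
    have "\<not> r' < m" using 1 mod rr(1) by auto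
    with rr(2) show ?thesis
      using 1 tick_nonneg[of m R "r' - 2 * m"] tick_nonneg[of m R "r' - (2 * m + 4 * R * m)"]
      by (cases rule: block_position_cases) (auto simp: defs)
  next
    case 2
    have "\<not> r' < 2 * m"
    proof
      assume "r' < 2 * m"
      then have "r' - m < m" "r - m < m" "r = m + (r - m)" "r' = m + (r' - m)" using 2 rr by auto
      then have "r mod m = r - m" "r' mod m = r' - m" by (metis mod_add_self1 mod_less)+
      then show False using mod rr 2 by simp
    qed
    with rr(2) show ?thesis
      using 2 rr(1) tick_nonneg[of m R "r' - 2 * m"] tick_nonneg[of m R "r' - (2 * m + 4 * R * m)"]
      by (cases rule: block_position_cases) (auto simp: defs)
  next
    case 3
    have "m dvd 2 * m" by simp
    then show ?thesis
      using 3 rr(1) tick_step[of "2 * m"] tick_nonneg[of m R "r' - (2 * m + 4 * R * m)"]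
      by (auto simp: defs)
  next
    case 4
    have "m dvd 2 * m + 4 * R * m" by simp
    then show ?thesis
      using 4 rr(1) tick_step[of "2 * m + 4 * R * m"] by (auto simp: defs)
  qed
qed

text \<open>Job \<open>j\<close> runs on machine \<open>j mod m\<close>. As \<open>m\<close> divides
  the block length, each machine receives per round one long job of each size and one tiny job per
  tick. A round costs at most \<open>2 * m * 6\<close> for the long jobs and
  \<open>8 * R * m\<close> times \<open>1 / (8 * R)\<close> for the tiny ones, together
  \<open>13 * m\<close>.\<close>

lemma OPT_hard_instance:
  assumes m: "0 < m" and R: "0 < R"
  shows "OPT m (hard_instance m R w) \<le> ennreal (13 * real m * real R)"
proof -
  define B where "B = block m R"
  define J where "J = hard_instance m R w"
  define st where "st j = offline_start m R w (j div B) (j mod B)" for j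
  define en where "en j = offline_stop m R w (j div B) (j mod B)" for j
  define run where "run j = Run j (j mod m) (st j) (en j)" for j
  define S where "S = run ` {..<R * B}"
  have B: "0 < B" "m dvd B" using m by (auto simp: B_def block_def)
  have len: "length J = R * B" by (simp add: J_def B_def)
  have job: "J ! j = hard_job m R w (j div B) (j mod B)" if "j < R * B" for j
    using that by (simp add: J_def B_def nth_hard_instance)
  have r: "j mod B < block m R" for j using B by (simp add: B_def)
  have bnd: "6 * real (j div B) \<le> st j" "en j \<le> 6 * real (j div B) + 6" for j
    using offline_bounds[OF r[of j], of "j div B" w] by (auto simp: st_def en_def)
  have disj: "en j \<le> st j' \<or> en j' \<le> st j" if "j < j'" "j mod m = j' mod m" for j j'
  proof (cases "j div B = j' div B")
    case True
    then have "j mod B < j' mod B" using that(1) by (metis mult_div_mod_eq nat_add_left_cancel_less)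
    moreover have "j mod B mod m = j' mod B mod m" using that(2) B(2) by (simp add: mod_mod_cancel)
    ultimately show ?thesis
      using offline_disjoint_round[OF _ r _ m R] True unfolding st_def en_def by metis
  next
    case False
    then have "Suc (j div B) \<le> j' div B" using div_le_mono[of j j' B] that(1) by linarith
    then have "6 * real (j div B) + 6 \<le> 6 * real (j' div B)" by linarith
    then show ?thesis using bnd(1)[of j'] bnd(2)[of j] by linarith
  qed
  have "finite S" by (simp add: S_def)
  have runs: "run_job (run j) = j" "run_machine (run j) = j mod m" "run_start (run j) = st j"
    "run_stop (run j) = en j" for j by (auto simp: run_def)
  have proc: "en j = st j + proc J j" "0 < proc J j" "0 \<le> release J j" "release J j \<le> st j"
    "6 * real (j div B) \<le> release J j" if "j < R * B" for j
    using that offline_bounds[OF r[of j], of "j div B" w] hard_job_proc_pos[OF R]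
    by (auto simp: job en_def st_def offline_stop_def intro: order_trans[rotated])
  have sched: "nonpreemptive_schedule m J S"
    unfolding nonpreemptive_schedule_def restart_schedule_def
  proof (intro conjI ballI allI impI)
    fix x y assume "x \<in> S" "y \<in> S" "x \<noteq> y \<and> (run_machine x = run_machine y \<or> run_job x = run_job y)"
    moreover from this obtain j j' where "x = run j" "y = run j'" by (auto simp: S_def)
    ultimately have "x = run j" "y = run j'" "j \<noteq> j'" "j mod m = j' mod m" by (auto simp: runs)
    then show "run_stop x \<le> run_start y \<or> run_stop y \<le> run_start x"
      using disj[of j j'] disj[of j' j] by (auto simp: runs neq_iff)
  next
    fix j assume "j < length J"
    then show "\<exists>!x. x \<in> S \<and> run_job x = j" by (auto simp: S_def runs len)
  qed (use m proc \<open>finite S\<close> in \<open>auto simp: S_def runs len completes_def\<close>)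
  define cost where "cost r = (if r < 2 * m then 6 else 1 / (8 * real R))" for r
  have cost0: "0 \<le> cost r" for r by (simp add: cost_def)
  have flow: "flow_time J S j \<le> ennreal (cost (j mod B))" if j: "j < R * B" for j
  proof -
    have "completion_time J S j \<le> ennreal (run_stop (run j))"
      unfolding completion_time_def
      using j proc by (intro INF_lower) (auto simp: S_def runs completes_def)
    then have "flow_time J S j \<le> ennreal (en j) - ennreal (release J j)"
      by (intro ennreal_minus_mono) (auto simp: runs)
    also have "\<dots> = ennreal (en j - release J j)"
      using proc(3)[OF j] by (simp add: ennreal_minus)
    also have "\<dots> \<le> ennreal (cost (j mod B))"
    proof (rule ennreal_leI)
      have "en j - release J j \<le> 6" using bnd(2)[of j] proc(5)[OF j] by linarith
      moreover have "en j - release J j = 1 / (8 * real R)" if "\<not> j mod B < 2 * m"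
        using that job[OF j]
        by (auto simp: en_def offline_stop_def offline_start_def hard_job_def)
      ultimately show "en j - release J j \<le> cost (j mod B)" by (auto simp: cost_def)
    qed
    finally show ?thesis .
  qed
  have "OPT m J \<le> total_flow_time J S"
    unfolding OPT_def using sched by (intro INF_lower) simp
  also have "\<dots> \<le> (\<Sum>j<R * B. ennreal (cost (j mod B)))"
    unfolding total_flow_time_def len using flow by (intro sum_mono) auto
  also have "\<dots> = ennreal (\<Sum>j<R * B. cost (j mod B))"
    by (intro sum_ennreal cost0)
  also have "(\<Sum>j<R * B. cost (j mod B)) = (\<Sum>i<R. \<Sum>r<B. cost r)"
    by (rule sum_blocks[OF B(1)])
  also have "(\<Sum>r<B. cost r) = 13 * real m"
  proof -
    have "{..<B} \<inter> {r. r < 2 * m} = {..<2 * m}" "{..<B} \<inter> - {r. r < 2 * m} = {2 * m..<B}"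
      by (auto simp: B_def block_def)
    then have "(\<Sum>r<B. cost r) = real (2 * m) * 6 + real (B - 2 * m) / (8 * real R)"
      by (simp add: cost_def sum.If_cases)
    also have "B - 2 * m = 8 * R * m" by (simp add: B_def block_def)
    finally show ?thesis using R by simp
  qed
  finally show ?thesis by (simp add: J_def mult.commute)
qed

subsection \<open>The lower bound\<close>

lemma single_job_flow_ge:
  assumes "restart_schedule m [(0, 1)] S"
  shows "1 \<le> total_flow_time [(0, 1)] S"
proof -
  have "1 \<le> completion_time [(0, 1)] S 0"
    unfolding completion_time_def
  proof (rule INF_greatest)
    fix x assume x: "x \<in> {x \<in> S. run_job x = 0 \<and> completes [(0, 1)] x}"
    then have "0 \<le> run_start x" using restart_scheduleD[OF assms, of x] by auto
    then have "1 \<le> run_stop x" using x by (auto simp: completes_def)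
    then show "1 \<le> ennreal (run_stop x)" by simp
  qed
  then show ?thesis by (simp add: total_flow_time_def)
qed

lemma OPT_single_job:
  assumes "0 < m"
  shows "OPT m [(0, 1)] \<le> 1"
proof -
  let ?S = "{Run 0 0 0 1}"
  have "nonpreemptive_schedule m [(0, 1)] ?S"
    using assms by (auto simp: nonpreemptive_schedule_def restart_schedule_def completes_def)
  then have "OPT m [(0, 1)] \<le> total_flow_time [(0, 1)] ?S"
    unfolding OPT_def by (intro INF_lower) simp
  also have "\<dots> \<le> 1"
    by (simp add: total_flow_time_def completion_time_def completes_def cong: conj_cong)
  finally show ?thesis .
qed

text \<open>Handles \<open>n < 10 * m\<close>, where not even one round fits: a single unit job
  forces ratio at least 1.\<close>

lemma small_ratio_unattainable:
  assumes M: "randomized_online_algorithm n m M" and "1 \<le> n" "0 < m" "c < 1"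
  shows "\<exists>J. valid_instance n J \<and> ennreal c * OPT m J < expected_flow_time M J"
proof (intro exI conjI)
  interpret prob_space M using M by (simp add: randomized_online_algorithm_def)
  show valid: "valid_instance n [(0, 1)]" using assms(2) by (simp add: valid_instance_def)
  have "ennreal c * OPT m [(0, 1)] \<le> ennreal c * 1"
    using OPT_single_job[OF assms(3)] by (intro mult_left_mono) auto
  also have "\<dots> < 1" using assms(4) by (simp add: ennreal_less_one_iff)
  also have "1 = (\<integral>\<^sup>+ A. 1 \<partial>M)" by (simp add: emeasure_space_1)
  also have "\<dots> \<le> expected_flow_time M [(0, 1)]"
    unfolding expected_flow_time_def
  proof (rule nn_integral_mono)
    fix A assume "A \<in> space M"
    then have "restart_schedule m [(0, 1)] (A [(0, 1)])"
      using M valid unfolding randomized_online_algorithm_def online_algorithm_def by blast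
    then show "1 \<le> total_flow_time [(0, 1)] (A [(0, 1)])" by (rule single_job_flow_ge)
  qed
  finally show "ennreal c * OPT m [(0, 1)] < expected_flow_time M [(0, 1)]" .
qed

text \<open>Yao's averaging argument: expectation and the finite sum over \<open>w\<close> are
  exchanged. The average cost is at least \<open>m * R^2 / 300\<close> and the optimum at most
  \<open>13 * m * R\<close>; \<open>3900 = 300 * 13\<close>.\<close>

lemma randomized_ratio_ge:
  assumes M: "randomized_online_algorithm n m M" and m: "0 < m" and R: "0 < R"
    and n: "R * block m R \<le> n" and G: "0 \<le> G"
    and ratio: "\<And>J. valid_instance n J \<Longrightarrow> expected_flow_time M J \<le> ennreal G * OPT m J"
  shows "real R \<le> 3900 * G"
proof -
  interpret prob_space M using M by (simp add: randomized_online_algorithm_def)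
  let ?J = "hard_instance m R"
  have valid: "valid_instance n (?J w)" for w by (rule valid_hard_instance[OF m R n])
  have "ennreal (2 ^ R * real m * (real R)\<^sup>2 / 300)
      = (\<integral>\<^sup>+ A. ennreal (2 ^ R * real m * (real R)\<^sup>2 / 300) \<partial>M)" by (simp add: emeasure_space_1)
  also have "\<dots> \<le> (\<integral>\<^sup>+ A. (\<Sum>w\<in>Pow {..<R}. total_flow_time (?J w) (A (?J w))) \<partial>M)"
    using M by (intro nn_integral_mono online_average_cost[OF _ m R n])
      (auto simp: randomized_online_algorithm_def)
  also have "\<dots> = (\<Sum>w\<in>Pow {..<R}. expected_flow_time M (?J w))"
    unfolding expected_flow_time_def using M valid
    by (intro nn_integral_sum) (auto simp: randomized_online_algorithm_def)
  also have "\<dots> \<le> (\<Sum>w\<in>Pow {..<R}. ennreal (G * (13 * real m * real R)))"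
  proof (rule sum_mono)
    fix w
    have "expected_flow_time M (?J w) \<le> ennreal G * OPT m (?J w)" by (rule ratio[OF valid])
    also have "\<dots> \<le> ennreal G * ennreal (13 * real m * real R)"
      by (intro mult_left_mono OPT_hard_instance[OF m R]) simp
    finally show "expected_flow_time M (?J w) \<le> ennreal (G * (13 * real m * real R))"
      using G by (simp add: ennreal_mult)
  qed
  also have "\<dots> = ennreal (2 ^ R * (G * (13 * real m * real R)))"
    using G by (simp add: card_Pow ennreal_mult flip: ennreal_power ennreal_numeral)
  finally have "2 ^ R * real m * (real R)\<^sup>2 / 300 \<le> 2 ^ R * (G * (13 * real m * real R))"
    using G by (subst (asm) ennreal_le_iff) auto
  then have "(2 ^ R * real m * real R) * real R \<le> (2 ^ R * real m * real R) * (3900 * G)"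
    by (simp add: power2_eq_square algebra_simps)
  then show ?thesis using m R by (subst (asm) mult_le_cancel_left_pos) auto
qed

theorem mainTheorem4:
  "\<exists>c::real. c > 0 \<and>
     (\<forall>n m :: nat. n \<ge> 1 \<longrightarrow> m \<ge> 1 \<longrightarrow>
       \<not> (\<exists>M. randomized_online_algorithm n m M \<and>
            (\<forall>J. valid_instance n J \<longrightarrow>
               expected_flow_time M J \<le> ennreal (c * sqrt (real n / real m)) * OPT m J)))"
proof (intro exI conjI allI impI notI)
  \<comment> \<open>For \<open>R \<ge> 1\<close> the contradiction needs \<open>R\<close> to exceed
    \<open>3900 * c * 4 * s\<close>, where \<open>s < R + 1 \<le> 2 * R\<close>;
    \<open>3900 * 4 * 2 = 31200 < 40000\<close> suffices.\<close>
  show "(0::real) < 1 / 40000" by simp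
next
  fix n m :: nat
  assume nm: "1 \<le> n" "1 \<le> m"
    and "\<exists>M. randomized_online_algorithm n m M \<and> (\<forall>J. valid_instance n J \<longrightarrow>
      expected_flow_time M J \<le> ennreal (1 / 40000 * sqrt (real n / real m)) * OPT m J)"
  then obtain M where M: "randomized_online_algorithm n m M"
    and ratio: "\<And>J. valid_instance n J \<Longrightarrow>
      expected_flow_time M J \<le> ennreal (1 / 40000 * sqrt (real n / real m)) * OPT m J" by blast
  \<comment> \<open>\<open>R\<close> rounds use \<open>R * (2 + 8 * R) * m\<close> jobs, at most
    \<open>10 * R^2 * m\<close>; \<open>s\<close> is the real solution of
    \<open>10 * s^2 * m = n\<close>.\<close>
  define s where "s = sqrt (real n / real m / 10)"
  define R where "R = nat \<lfloor>s\<rfloor>"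
  have s: "0 \<le> s" "s\<^sup>2 = real n / real m / 10" by (auto simp: s_def)
  have "sqrt (real n / real m) = sqrt (10 * s\<^sup>2)" by (simp add: s(2))
  also have "\<dots> \<le> sqrt ((4 * s)\<^sup>2)" by (intro real_sqrt_le_mono) (simp add: power_mult_distrib)
  also have "\<dots> = 4 * s" using s(1) by (intro real_sqrt_unique) auto
  finally have root: "sqrt (real n / real m) \<le> 4 * s" .
  have R: "real R \<le> s" "s < real R + 1"
    using s(1) by (auto simp: R_def)
  show False
  proof (cases "R = 0")
    case True
    then have "1 / 40000 * sqrt (real n / real m) < 1" using root R(2) by linarith
    from small_ratio_unattainable[OF M nm(1) _ this] nm(2)
    obtain J where "valid_instance n J"
      "ennreal (1 / 40000 * sqrt (real n / real m)) * OPT m J < expected_flow_time M J" by auto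
    then show False using ratio[of J] by simp
  next
    case False
    have "(real R)\<^sup>2 \<le> s\<^sup>2" using R(1) by (intro power_mono) auto
    then have "10 * (real R)\<^sup>2 * real m \<le> real n"
      using nm(2) by (simp add: s(2) field_simps)
    then have "real (10 * R * R * m) \<le> real n" by (simp add: power2_eq_square algebra_simps)
    then have "10 * R * R * m \<le> n" by (simp only: of_nat_le_iff)
    moreover have "R * m \<le> R * (R * m)" using False by simp
    moreover have "R * block m R = 2 * (R * m) + 8 * (R * (R * m))"
      by (simp add: block_def algebra_simps)
    moreover have "10 * R * R * m = 10 * (R * (R * m))" by simp
    ultimately have "R * block m R \<le> n" by linarith
    then have "real R \<le> 3900 * (1 / 40000 * sqrt (real n / real m))"
      using nm(2) False by (intro randomized_ratio_ge[OF M _ _ _ _ ratio]) auto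
    then show False using root R(2) False by auto
  qed
qed

end
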